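(* Let $S$ be a proper restriction semigroup. The following are equivalent: (a) $S$ is almost left factorizable [almost right factorizable, almost factorizable]; (b) $S$ is almost $T$-proper, where $T$ is the $\mathbb R$-class [$\mathbb L$-class, $\mathbb H$-class] of the identity in $C(S)$ (that is, $C(S)$ is $T$-proper for this submonoid $T$); (c) the action of $S/\sigma$ on $P_S$ by isomorphisms between ideals of $P_S$ that is induced by the Munn representation of $S$ (namely $t\mapsto(t\kappa)\overline\theta$) is by endomorphisms [onto mappings, automorphisms]; that is, every $(t\kappa)\overline\theta$ has domain $P_S$ [has range $P_S$, has both domain and range $P_S$]; (d) $S\cong W(T,Y)$ for such an action of a monoid $T$ on a semilattice $Y$; that is, for some monoidal homomorphism $T\to TI_Y$ such that $\Delta t=Y$ [$\nabla t=Y$, $\Delta t=\nabla t=Y$] for all $t\in T$. (Three sets of equivalences are asserted: the left case, and the two bracketed alternatives read consistently.)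
   Context: A restriction semigroup is an algebra $(S,\cdot,{}^+,{}^* )$ with $(S,\cdot)$ a semigroup, satisfying $x^+x=x$, $(x^+y)^+=x^+y^+$, $x^+y^+=y^+x^+$, $xy^+=(xy)^+x$, the dual identities $xx^*=x$, $(yx^* )^*=y^*x^*$, $y^*x^*=x^*y^*$, $y^*x=x(yx)^*$, and $(x^+)^*=x^+$, $(x^* )^+=x^*$. Its projections form the semilattice $P_S=\{x^+:x\in S\}=\{x^*:x\in S\}$. A restriction monoid is a restriction semigroup with identity $1$ (so $1^+=1^*=1$). The natural partial order is $a\le b$ iff $a=eb$ for some $e\in P_S$; order ideals are nonempty downward-closed subsets. Relations on $S$: $a\mathrel{\mathbb R}b$ iff $a^+=b^+$; $a\mathrel{\mathbb L}b$ iff $a^*=b^*$; $\mathbb H=\mathbb L\cap\mathbb R$; $\sigma=\{(a,b): ea=eb\text{ for some }e\in P_S\}$ is the least congruence identifying all projections. $S$ is proper if $\mathbb R\cap\sigma$ and $\mathbb L\cap\sigma$ are both the identity relation. In a restriction monoid the $\mathbb R$-, $\mathbb L$- and $\mathbb H$-classes of $1$ are submonoids. A restriction monoid $M$ with plain submonoid $T$ is $T$-proper if $M=P_MT$ and $\sigma$ separates $T$. A permissible subset of $S$ is an order ideal $A$ with $a^+b=b^+a$ and $ab^*=ba^*$ for all $a,b\in A$; the set $C(S)$ of permissible subsets is a restriction monoid under multiplication of subsets, with $A^+=\{a^+:a\in A\}$, $A^*=\{a^*:a\in A\}$ and identity $P_S$. $S$ is almost $T$-proper if $C(S)$ is $T$-proper.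 $S$ is almost left factorizable [almost right factorizable, almost factorizable] if every element of $S$ belongs to some member of the $\mathbb R$-class [$\mathbb L$-class, $\mathbb H$-class] of the identity in $C(S)$. For a semilattice $Y$, ideals are nonempty downward-closed subsets. $TI_Y$ is the inverse monoid of all isomorphisms between ideals of $Y$, under composition of partial maps (written on the right, composed left to right); $T_Y$ is its inverse subsemigroup of isomorphisms between principal ideals. The Munn representation of $S$ is $\theta:S\to T_{P_S}$, where $\theta_a$ has domain $\{e\in P_S:e\le a^+\}$ and $e\theta_a=(ea)^*$. Its extension $\overline\theta:C(S)\to TI_{P_S}$ sends $A$ to $\overline\theta_A=\bigcup_{a\in A}\theta_a$, an isomorphism from the ideal $A^+$ onto the ideal $A^*$. When $S$ is proper, each $\sigma$-class is permissible and $\kappa:S/\sigma\to C(S)$ is the inclusion of the set of $\sigma$-classes. Given a monoidal homomorphism $\alpha:T\to TI_Y$, write $\Delta t,\nabla t$ for the domain and range of $t\alpha$, and $e^t=e(t\alpha)$ for $e\in\Delta t$. Then $W(T,Y)=\{(t,e^t)\in T\times Y: e\in\Delta t\}=\{(t,f)\in T\times Y: f\in\nabla t\}$, with $(t,e^t)(u,f^u)=(tu,(e^tf)^u)$, $(t,e^t)^+=(1,e)$, $(t,f)^*=(1,f)$. *)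

theory Defs
  imports "HOL-Algebra.Group"
begin

section \<open>Restriction semigroups and monoids\<close>

record 'a rsemigroup = "'a partial_object" +
  rmult :: "['a, 'a] \<Rightarrow> 'a"  (infixl "\<cdot>\<index>" 70)
  rplus :: "'a \<Rightarrow> 'a"
  rstar :: "'a \<Rightarrow> 'a"

record 'a rmonoid = "'a rsemigroup" +
  rone :: 'a

locale restriction_semigroup =
  fixes S (structure)
  assumes nonempty: "carrier S \<noteq> {}"
    and mult_closed: "\<lbrakk>x \<in> carrier S; y \<in> carrier S\<rbrakk> \<Longrightarrow> x \<cdot> y \<in> carrier S"
    and plus_closed: "x \<in> carrier S \<Longrightarrow> rplus S x \<in> carrier S"
    and star_closed: "x \<in> carrier S \<Longrightarrow> rstar S x \<in> carrier S"
    and assoc: "\<lbrakk>x \<in> carrier S; y \<in> carrier S; z \<in> carrier S\<rbrakk> \<Longrightarrow> (x \<cdot> y) \<cdot> z = x \<cdot> (y \<cdot> z)"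
    and plus_left_id: "x \<in> carrier S \<Longrightarrow> rplus S x \<cdot> x = x"
    and plus_plus: "\<lbrakk>x \<in> carrier S; y \<in> carrier S\<rbrakk>
          \<Longrightarrow> rplus S (rplus S x \<cdot> y) = rplus S x \<cdot> rplus S y"
    and plus_comm: "\<lbrakk>x \<in> carrier S; y \<in> carrier S\<rbrakk>
          \<Longrightarrow> rplus S x \<cdot> rplus S y = rplus S y \<cdot> rplus S x"
    and plus_ample: "\<lbrakk>x \<in> carrier S; y \<in> carrier S\<rbrakk>
          \<Longrightarrow> x \<cdot> rplus S y = rplus S (x \<cdot> y) \<cdot> x"
    and star_right_id: "x \<in> carrier S \<Longrightarrow> x \<cdot> rstar S x = x"
    and star_star: "\<lbrakk>x \<in> carrier S; y \<in> carrier S\<rbrakk>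
          \<Longrightarrow> rstar S (y \<cdot> rstar S x) = rstar S y \<cdot> rstar S x"
    and star_comm: "\<lbrakk>x \<in> carrier S; y \<in> carrier S\<rbrakk>
          \<Longrightarrow> rstar S y \<cdot> rstar S x = rstar S x \<cdot> rstar S y"
    and star_ample: "\<lbrakk>x \<in> carrier S; y \<in> carrier S\<rbrakk>
          \<Longrightarrow> rstar S y \<cdot> x = x \<cdot> rstar S (y \<cdot> x)"
    and star_of_plus: "x \<in> carrier S \<Longrightarrow> rstar S (rplus S x) = rplus S x"
    and plus_of_star: "x \<in> carrier S \<Longrightarrow> rplus S (rstar S x) = rstar S x"

locale restriction_monoid = restriction_semigroup +
  assumes one_closed: "rone S \<in> carrier S"
    and one_left: "x \<in> carrier S \<Longrightarrow> rone S \<cdot> x = x"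
    and one_right: "x \<in> carrier S \<Longrightarrow> x \<cdot> rone S = x"

definition plain_monoid :: "('a, 'm) rmonoid_scheme \<Rightarrow> 'a monoid" where
  "plain_monoid M = \<lparr>carrier = carrier M, mult = rmult M, one = rone M\<rparr>"

definition rsemigroup_iso ::
    "('a, 'm) rsemigroup_scheme \<Rightarrow> ('b, 'n) rsemigroup_scheme \<Rightarrow> bool" where
  "rsemigroup_iso S U \<longleftrightarrow>
     (\<exists>h. bij_betw h (carrier S) (carrier U) \<and>
          (\<forall>x\<in>carrier S. \<forall>y\<in>carrier S. h (x \<cdot>\<^bsub>S\<^esub> y) = h x \<cdot>\<^bsub>U\<^esub> h y) \<and>
          (\<forall>x\<in>carrier S. h (rplus S x) = rplus U (h x)) \<and>
          (\<forall>x\<in>carrier S. h (rstar S x) = rstar U (h x)))"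

definition projections :: "('a, 'm) rsemigroup_scheme \<Rightarrow> 'a set" where
  "projections S = rplus S ` carrier S"

definition nat_le :: "('a, 'm) rsemigroup_scheme \<Rightarrow> 'a \<Rightarrow> 'a \<Rightarrow> bool" where
  "nat_le S a b \<longleftrightarrow> (\<exists>e\<in>projections S. a = e \<cdot>\<^bsub>S\<^esub> b)"

definition R_rel :: "('a, 'm) rsemigroup_scheme \<Rightarrow> ('a \<times> 'a) set" where
  "R_rel S = {(a, b). a \<in> carrier S \<and> b \<in> carrier S \<and> rplus S a = rplus S b}"

definition L_rel :: "('a, 'm) rsemigroup_scheme \<Rightarrow> ('a \<times> 'a) set" where
  "L_rel S = {(a, b). a \<in> carrier S \<and> b \<in> carrier S \<and> rstar S a = rstar S b}"

definition H_rel :: "('a, 'm) rsemigroup_scheme \<Rightarrow> ('a \<times> 'a) set" where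
  "H_rel S = L_rel S \<inter> R_rel S"

definition sigma :: "('a, 'm) rsemigroup_scheme \<Rightarrow> ('a \<times> 'a) set" where
  "sigma S = {(a, b). a \<in> carrier S \<and> b \<in> carrier S \<and>
                      (\<exists>e\<in>projections S. e \<cdot>\<^bsub>S\<^esub> a = e \<cdot>\<^bsub>S\<^esub> b)}"

definition proper :: "('a, 'm) rsemigroup_scheme \<Rightarrow> bool" where
  "proper S \<longleftrightarrow> R_rel S \<inter> sigma S = Id_on (carrier S) \<and> L_rel S \<inter> sigma S = Id_on (carrier S)"

definition R_class_one :: "('a, 'm) rmonoid_scheme \<Rightarrow> 'a set" where
  "R_class_one M = R_rel M `` {rone M}"

definition L_class_one :: "('a, 'm) rmonoid_scheme \<Rightarrow> 'a set" where
  "L_class_one M = L_rel M `` {rone M}"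

definition H_class_one :: "('a, 'm) rmonoid_scheme \<Rightarrow> 'a set" where
  "H_class_one M = H_rel M `` {rone M}"

definition T_proper :: "('a, 'm) rmonoid_scheme \<Rightarrow> 'a set \<Rightarrow> bool" where
  "T_proper M T \<longleftrightarrow>
     restriction_monoid M \<and> submonoid T (plain_monoid M) \<and>
     carrier M = {e \<cdot>\<^bsub>M\<^esub> t | e t. e \<in> projections M \<and> t \<in> T} \<and>
     (\<forall>s\<in>T. \<forall>t\<in>T. (s, t) \<in> sigma M \<longrightarrow> s = t)"

section \<open>Permissible subsets\<close>

definition order_ideal :: "('a, 'm) rsemigroup_scheme \<Rightarrow> 'a set \<Rightarrow> bool" where
  "order_ideal S A \<longleftrightarrow>
     A \<subseteq> carrier S \<and> A \<noteq> {} \<and> (\<forall>b\<in>A. \<forall>a\<in>carrier S. nat_le S a b \<longrightarrow> a \<in> A)"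

definition permissible :: "('a, 'm) rsemigroup_scheme \<Rightarrow> 'a set \<Rightarrow> bool" where
  "permissible S A \<longleftrightarrow>
     order_ideal S A \<and>
     (\<forall>a\<in>A. \<forall>b\<in>A. rplus S a \<cdot>\<^bsub>S\<^esub> b = rplus S b \<cdot>\<^bsub>S\<^esub> a \<and>
                    a \<cdot>\<^bsub>S\<^esub> rstar S b = b \<cdot>\<^bsub>S\<^esub> rstar S a)"

definition permissible_monoid :: "('a, 'm) rsemigroup_scheme \<Rightarrow> 'a set rmonoid" where
  "permissible_monoid S =
     \<lparr>carrier = {A. permissible S A},
      rmult = (\<lambda>A B. {a \<cdot>\<^bsub>S\<^esub> b | a b. a \<in> A \<and> b \<in> B}),
      rplus = (\<lambda>A. rplus S ` A),
      rstar = (\<lambda>A. rstar S ` A),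
      rone = projections S\<rparr>"

definition almost_T_proper :: "('a, 'm) rsemigroup_scheme \<Rightarrow> 'a set set \<Rightarrow> bool" where
  "almost_T_proper S T \<longleftrightarrow> T_proper (permissible_monoid S) T"

definition almost_left_factorizable :: "('a, 'm) rsemigroup_scheme \<Rightarrow> bool" where
  "almost_left_factorizable S \<longleftrightarrow>
     (\<forall>s\<in>carrier S. \<exists>A\<in>R_class_one (permissible_monoid S). s \<in> A)"

definition almost_right_factorizable :: "('a, 'm) rsemigroup_scheme \<Rightarrow> bool" where
  "almost_right_factorizable S \<longleftrightarrow>
     (\<forall>s\<in>carrier S. \<exists>A\<in>L_class_one (permissible_monoid S). s \<in> A)"

definition almost_factorizable :: "('a, 'm) rsemigroup_scheme \<Rightarrow> bool" where
  "almost_factorizable S \<longleftrightarrow>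
     (\<forall>s\<in>carrier S. \<exists>A\<in>H_class_one (permissible_monoid S). s \<in> A)"

section \<open>The Munn representation\<close>

text \<open>Partial maps are represented by their graphs. They are written on the right and
  composed from left to right, which is relational composition \<open>O\<close>.\<close>

definition munn :: "('a, 'm) rsemigroup_scheme \<Rightarrow> 'a \<Rightarrow> ('a \<times> 'a) set" where
  "munn S a =
     {(e, rstar S (e \<cdot>\<^bsub>S\<^esub> a)) | e. e \<in> projections S \<and> nat_le S e (rplus S a)}"

definition munn_ext :: "('a, 'm) rsemigroup_scheme \<Rightarrow> 'a set \<Rightarrow> ('a \<times> 'a) set" where
  "munn_ext S A = (\<Union>a\<in>A. munn S a)"

section \<open>Actions by isomorphisms between ideals of a semilattice\<close>

definition semilat_ideal :: "('y, 'm) gorder_scheme \<Rightarrow> 'y set \<Rightarrow> bool" where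
  "semilat_ideal Y I \<longleftrightarrow>
     I \<subseteq> carrier Y \<and> I \<noteq> {} \<and> (\<forall>y\<in>I. \<forall>x\<in>carrier Y. x \<sqsubseteq>\<^bsub>Y\<^esub> y \<longrightarrow> x \<in> I)"

definition ideal_iso :: "('y, 'm) gorder_scheme \<Rightarrow> ('y \<times> 'y) set \<Rightarrow> bool" where
  "ideal_iso Y \<phi> \<longleftrightarrow>
     single_valued \<phi> \<and> single_valued (\<phi>\<inverse>) \<and>
     semilat_ideal Y (Domain \<phi>) \<and> semilat_ideal Y (Range \<phi>) \<and>
     (\<forall>e f e' f'. (e, f) \<in> \<phi> \<longrightarrow> (e', f') \<in> \<phi> \<longrightarrow> (e \<sqinter>\<^bsub>Y\<^esub> e', f \<sqinter>\<^bsub>Y\<^esub> f') \<in> \<phi>)"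

definition TI :: "('y, 'm) gorder_scheme \<Rightarrow> ('y \<times> 'y) set monoid" where
  "TI Y = \<lparr>carrier = {\<phi>. ideal_iso Y \<phi>}, mult = (O), one = Id_on (carrier Y)\<rparr>"

definition monoidal_hom :: "('t, 'm) monoid_scheme \<Rightarrow> ('u, 'n) monoid_scheme \<Rightarrow> ('t \<Rightarrow> 'u) set" where
  "monoidal_hom T U = {\<alpha> \<in> hom T U. \<alpha> \<one>\<^bsub>T\<^esub> = \<one>\<^bsub>U\<^esub>}"

text \<open>Each \<open>\<alpha> t\<close> is meant to be an isomorphism between ideals of \<open>Y\<close>; it is an endomorphism
  of \<open>Y\<close> as soon as it is total, and an automorphism when it is also onto. The class
  \<open>\<kappa>(t) \<in> C(S)\<close> of \<open>t \<in> S / \<sigma>\<close> is \<open>t\<close> itself, so the action induced by the Munn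
  representation is \<open>munn_ext S\<close> on the \<open>\<sigma>\<close>-classes.\<close>

definition acts_by_endomorphisms :: "'t set \<Rightarrow> 'y set \<Rightarrow> ('t \<Rightarrow> ('y \<times> 'y) set) \<Rightarrow> bool" where
  "acts_by_endomorphisms T Y \<alpha> \<longleftrightarrow> (\<forall>t\<in>T. Domain (\<alpha> t) = Y)"

definition acts_by_onto_maps :: "'t set \<Rightarrow> 'y set \<Rightarrow> ('t \<Rightarrow> ('y \<times> 'y) set) \<Rightarrow> bool" where
  "acts_by_onto_maps T Y \<alpha> \<longleftrightarrow> (\<forall>t\<in>T. Range (\<alpha> t) = Y)"

definition acts_by_automorphisms :: "'t set \<Rightarrow> 'y set \<Rightarrow> ('t \<Rightarrow> ('y \<times> 'y) set) \<Rightarrow> bool" where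
  "acts_by_automorphisms T Y \<alpha> \<longleftrightarrow> (\<forall>t\<in>T. Domain (\<alpha> t) = Y \<and> Range (\<alpha> t) = Y)"

section \<open>The restriction semigroup \<open>W(T, Y)\<close>\<close>

text \<open>The value at \<open>e\<close> of a partial map given by its graph; meaningful only on the domain.\<close>

definition app :: "('y \<times> 'y) set \<Rightarrow> 'y \<Rightarrow> 'y" where
  "app \<phi> e = (THE f. (e, f) \<in> \<phi>)"

text \<open>The operations are given on pairs \<open>(t, a)\<close> with \<open>a\<close> in the range of \<open>\<alpha> t\<close>, so the
  \<open>e\<close> with \<open>a = e\<^sup>t\<close> is recovered as \<open>app ((\<alpha> t)\<inverse>) a\<close>.\<close>

definition W :: "('t, 'm) monoid_scheme \<Rightarrow> ('y, 'n) gorder_scheme \<Rightarrow> ('t \<Rightarrow> ('y \<times> 'y) set)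
    \<Rightarrow> ('t \<times> 'y) rsemigroup" where
  "W T Y \<alpha> =
     \<lparr>carrier = {(t, app (\<alpha> t) e) | t e. t \<in> carrier T \<and> e \<in> Domain (\<alpha> t)},
      rmult = (\<lambda>(t, a) (u, b). (t \<otimes>\<^bsub>T\<^esub> u, app (\<alpha> u) (a \<sqinter>\<^bsub>Y\<^esub> app ((\<alpha> u)\<inverse>) b))),
      rplus = (\<lambda>(t, a). (\<one>\<^bsub>T\<^esub>, app ((\<alpha> t)\<inverse>) a)),
      rstar = (\<lambda>(t, a). (\<one>\<^bsub>T\<^esub>, a))\<rparr>"

text \<open>Being isomorphic to some \<open>W(T, Y)\<close> whose action satisfies \<open>cond\<close>. Since HOL has no
  quantification over types, the element types of \<open>T\<close> and \<open>Y\<close> are parameters. No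
  generality is lost at \<open>'a set\<close> and \<open>'a\<close>, where \<open>S / \<sigma>\<close> and the projections of \<open>S\<close> live:
  \<open>W(T, Y)\<close> always projects onto \<open>T\<close> and contains a copy of \<open>Y\<close>.\<close>

definition iso_to_W :: "'t itself \<Rightarrow> 'y itself
    \<Rightarrow> ('t set \<Rightarrow> 'y set \<Rightarrow> ('t \<Rightarrow> ('y \<times> 'y) set) \<Rightarrow> bool)
    \<Rightarrow> ('a, 'm) rsemigroup_scheme \<Rightarrow> bool" where
  "iso_to_W _ _ cond S \<longleftrightarrow>
     (\<exists>(T :: 't monoid) (Y :: 'y gorder) \<alpha>.
        monoid T \<and> lower_semilattice Y \<and> carrier Y \<noteq> {} \<and> \<alpha> \<in> monoidal_hom T (TI Y) \<and>
        cond (carrier T) (carrier Y) \<alpha> \<and> rsemigroup_iso S (W T Y \<alpha>))"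

end

theory Submission
  imports Defs
begin

text \<open>
  The elements of a permissible subset are \<open>\<sigma>\<close>-related, and in a proper \<open>S\<close> every
  \<open>\<sigma>\<close>-class is permissible. An element of \<open>C(S)\<close> in the \<open>\<R>\<close>-class or the \<open>\<L>\<close>-class of the
  identity must therefore fill up its \<open>\<sigma>\<close>-class, so the submonoid \<open>T\<close> of the theorem is
  always a set of \<open>\<sigma>\<close>-classes, and (a), (b) and (c) each say that \<open>T\<close> contains all of them.
  In that case \<open>S / \<sigma>\<close> is itself a submonoid of \<open>C(S)\<close>, and \<open>s \<mapsto> (s\<sigma>, s\<^sup>*)\<close> is an
  isomorphism of \<open>S\<close> onto \<open>W(S / \<sigma>, P\<^sub>S)\<close>. Conversely, elements of \<open>W(T, Y)\<close> with the same
  first component are \<open>\<sigma>\<close>-related, so that fullness of the domains or ranges of a given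
  action carries over to the \<open>\<sigma>\<close>-classes.
\<close>

section \<open>Restriction semigroups\<close>

context restriction_semigroup
begin

declare mult_closed [simp] plus_closed [simp] star_closed [simp]

lemma proj_closed [simp]: "e \<in> projections S \<Longrightarrow> e \<in> carrier S"
  by (auto simp: projections_def)

lemma plus_proj [simp]: "x \<in> carrier S \<Longrightarrow> rplus S x \<in> projections S"
  by (auto simp: projections_def)

lemma star_proj [simp]: "x \<in> carrier S \<Longrightarrow> rstar S x \<in> projections S"
  by (metis plus_of_star plus_proj star_closed)

lemma projectionE:
  assumes "e \<in> projections S"
  obtains x where "x \<in> carrier S" "e = rplus S x"
  using assms unfolding projections_def by blast

lemma plus_of_proj [simp]: "e \<in> projections S \<Longrightarrow> rplus S e = e"
  using plus_of_star[OF plus_closed] by (auto elim!: projectionE simp: star_of_plus)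

lemma star_of_proj [simp]: "e \<in> projections S \<Longrightarrow> rstar S e = e"
  by (elim projectionE) (simp add: star_of_plus)

lemma projections_nonempty: "projections S \<noteq> {}"
  using nonempty unfolding projections_def by blast

lemma proj_mult [simp]: "e \<in> projections S \<Longrightarrow> f \<in> projections S \<Longrightarrow> e \<cdot> f \<in> projections S"
  using plus_plus[of e f] plus_proj[of "e \<cdot> f"] by simp

lemma proj_idem [simp]: "e \<in> projections S \<Longrightarrow> e \<cdot> e = e"
  by (metis plus_left_id plus_of_proj proj_closed)

lemma proj_comm: "e \<in> projections S \<Longrightarrow> f \<in> projections S \<Longrightarrow> e \<cdot> f = f \<cdot> e"
  by (metis plus_comm plus_of_proj proj_closed)

lemma plus_proj_mult [simp]:
  "e \<in> projections S \<Longrightarrow> x \<in> carrier S \<Longrightarrow> rplus S (e \<cdot> x) = e \<cdot> rplus S x"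
  by (metis plus_of_proj plus_plus proj_closed)

lemma star_mult_proj [simp]:
  "e \<in> projections S \<Longrightarrow> x \<in> carrier S \<Longrightarrow> rstar S (x \<cdot> e) = rstar S x \<cdot> e"
  by (metis star_of_proj star_star proj_closed)

lemma mult_proj: "e \<in> projections S \<Longrightarrow> x \<in> carrier S \<Longrightarrow> x \<cdot> e = rplus S (x \<cdot> e) \<cdot> x"
  by (metis plus_ample plus_of_proj proj_closed)

lemma proj_mult_star: "e \<in> projections S \<Longrightarrow> x \<in> carrier S \<Longrightarrow> e \<cdot> x = x \<cdot> rstar S (e \<cdot> x)"
  by (metis star_ample star_of_proj proj_closed)

text \<open>Left multiplication by \<open>x\<^sup>+\<close> fixes \<open>x y\<close>, so
  \<open>(x y)\<^sup>+\<close> lies below \<open>x\<^sup>+\<close>.\<close>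

lemma plus_mult_absorb:
  assumes "x \<in> carrier S" "y \<in> carrier S"
  shows "rplus S (x \<cdot> y) \<cdot> rplus S x = rplus S (x \<cdot> y)"
proof -
  have "rplus S (x \<cdot> y) \<cdot> rplus S x = rplus S (rplus S x \<cdot> (x \<cdot> y))"
    using assms by (simp add: proj_comm)
  also have "\<dots> = rplus S (x \<cdot> y)"
    using assms by (metis assoc plus_closed plus_left_id)
  finally show ?thesis .
qed

text \<open>The ample identity rewrites \<open>x y\<^sup>+\<close> as
  \<open>(x y)\<^sup>+ x\<close>, whose plus collapses by absorption. Hence
  \<open>(x y)\<^sup>+\<close> depends on \<open>y\<close> only through
  \<open>y\<^sup>+\<close>.\<close>

lemma plus_mult_plus:
  assumes "x \<in> carrier S" "y \<in> carrier S"
  shows "rplus S (x \<cdot> rplus S y) = rplus S (x \<cdot> y)"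
proof -
  have "rplus S (x \<cdot> rplus S y) = rplus S (rplus S (x \<cdot> y) \<cdot> x)"
    using plus_ample[OF assms] by simp
  also have "\<dots> = rplus S (x \<cdot> y)"
    using assms by (simp add: plus_mult_absorb)
  finally show ?thesis .
qed

lemma star_mult_absorb:
  assumes "x \<in> carrier S" "y \<in> carrier S"
  shows "rstar S y \<cdot> rstar S (x \<cdot> y) = rstar S (x \<cdot> y)"
proof -
  have "rstar S y \<cdot> rstar S (x \<cdot> y) = rstar S ((x \<cdot> y) \<cdot> rstar S y)"
    using assms by (simp add: proj_comm)
  also have "\<dots> = rstar S (x \<cdot> y)"
    using assms by (metis assoc star_closed star_right_id)
  finally show ?thesis .
qed

lemma star_mult_star:
  assumes "x \<in> carrier S" "y \<in> carrier S"
  shows "rstar S (rstar S x \<cdot> y) = rstar S (x \<cdot> y)"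
proof -
  have "rstar S (rstar S x \<cdot> y) = rstar S (y \<cdot> rstar S (x \<cdot> y))"
    using star_ample[OF assms(2,1)] by simp
  also have "\<dots> = rstar S (x \<cdot> y)"
    using assms by (simp add: star_mult_absorb)
  finally show ?thesis .
qed

lemma proj_left_comm:
  "e \<in> projections S \<Longrightarrow> f \<in> projections S \<Longrightarrow> x \<in> carrier S \<Longrightarrow> e \<cdot> (f \<cdot> x) = f \<cdot> (e \<cdot> x)"
  by (metis assoc proj_closed proj_comm)

section \<open>The monoid of permissible subsets\<close>

lemma permissible_carrier: "permissible S A \<Longrightarrow> a \<in> A \<Longrightarrow> a \<in> carrier S"
  by (auto simp: permissible_def order_ideal_def)

lemma permissible_nonempty: "permissible S A \<Longrightarrow> A \<noteq> {}"
  by (auto simp: permissible_def order_ideal_def)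

lemma permissible_plus:
  "permissible S A \<Longrightarrow> a \<in> A \<Longrightarrow> b \<in> A \<Longrightarrow> rplus S a \<cdot> b = rplus S b \<cdot> a"
  by (auto simp: permissible_def)

lemma permissible_star:
  "permissible S A \<Longrightarrow> a \<in> A \<Longrightarrow> b \<in> A \<Longrightarrow> a \<cdot> rstar S b = b \<cdot> rstar S a"
  by (auto simp: permissible_def)

lemma permissible_proj_mult:
  assumes "permissible S A" "e \<in> projections S" "a \<in> A"
  shows "e \<cdot> a \<in> A"
proof -
  have "nat_le S (e \<cdot> a) a" "e \<cdot> a \<in> carrier S"
    using assms permissible_carrier[OF assms(1,3)] by (auto simp: nat_le_def)
  then show ?thesis
    using assms by (auto simp: permissible_def order_ideal_def)
qed

text \<open>A right multiple by a projection is also a left multiple by one, so an order ideal,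
  although defined through left multiples, is closed on both sides.\<close>

lemma permissible_mult_proj:
  assumes "permissible S A" "e \<in> projections S" "a \<in> A"
  shows "a \<cdot> e \<in> A"
  using assms by (metis mult_proj mult_closed permissible_carrier permissible_proj_mult plus_proj proj_closed)

lemma permissibleI:
  assumes "A \<subseteq> carrier S" "A \<noteq> {}"
    and "\<And>a e. a \<in> A \<Longrightarrow> e \<in> projections S \<Longrightarrow> e \<cdot> a \<in> A"
    and "\<And>a b. a \<in> A \<Longrightarrow> b \<in> A \<Longrightarrow> rplus S a \<cdot> b = rplus S b \<cdot> a"
    and "\<And>a b. a \<in> A \<Longrightarrow> b \<in> A \<Longrightarrow> a \<cdot> rstar S b = b \<cdot> rstar S a"
  shows "permissible S A"
  unfolding permissible_def order_ideal_def nat_le_def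
  using assms by blast

text \<open>Projections commute and are fixed by both unary operations, which makes compatibility
  automatic and leaves only closure to check.\<close>

lemma permissible_subset_projections:
  assumes "A \<subseteq> projections S" "A \<noteq> {}"
    and "\<And>a e. a \<in> A \<Longrightarrow> e \<in> projections S \<Longrightarrow> e \<cdot> a \<in> A"
  shows "permissible S A"
  using assms by (intro permissibleI) (auto simp: subset_iff intro: proj_comm)

lemma permissible_projections: "permissible S (projections S)"
  using projections_nonempty by (intro permissible_subset_projections) auto

lemma permissible_image_plus:
  assumes "permissible S A"
  shows "permissible S (rplus S ` A)"
proof (rule permissible_subset_projections)
  fix a e assume "a \<in> rplus S ` A" "e \<in> projections S"
  then obtain b where "b \<in> A" "a = rplus S b" by auto
  then show "e \<cdot> a \<in> rplus S ` A"
    using assms \<open>e \<in> projections S\<close>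
    by (metis image_eqI permissible_carrier permissible_proj_mult plus_proj_mult)
qed (use assms permissible_carrier permissible_nonempty in auto)

lemma permissible_image_star:
  assumes "permissible S A"
  shows "permissible S (rstar S ` A)"
proof (rule permissible_subset_projections)
  fix a e assume "a \<in> rstar S ` A" "e \<in> projections S"
  then obtain b where "b \<in> A" "a = rstar S b" by auto
  then show "e \<cdot> a \<in> rstar S ` A"
    using assms \<open>e \<in> projections S\<close>
    by (metis image_eqI permissible_carrier permissible_mult_proj proj_comm star_mult_proj star_proj)
qed (use assms permissible_carrier permissible_nonempty in auto)

text \<open>Half of the compatibility of two products of permissible subsets. Only plus occurs in
  it, so the star half can be obtained by duality.\<close>

lemma mult_compatible_plus:
  assumes car: "a \<in> carrier S" "b \<in> carrier S" "c \<in> carrier S" "d \<in> carrier S"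
    and ac: "rplus S a \<cdot> c = rplus S c \<cdot> a" and bd: "rplus S b \<cdot> d = rplus S d \<cdot> b"
  shows "rplus S (a \<cdot> b) \<cdot> (c \<cdot> d) = rplus S (c \<cdot> d) \<cdot> (a \<cdot> b)"
proof -
  note ab = plus_mult_absorb[OF car(1,2), symmetric]
  \<comment> \<open>Absorption inserts \<open>a\<^sup>+\<close> in front of \<open>c\<close>, and
    \<open>a\<^sup>+ c\<close> can then be exchanged for \<open>c\<^sup>+ a\<close>.\<close>
  have "rplus S (a \<cdot> b) \<cdot> (c \<cdot> d) = rplus S (a \<cdot> b) \<cdot> ((rplus S a \<cdot> c) \<cdot> d)"
    by (subst ab) (simp add: car assoc)
  also have "\<dots> = rplus S c \<cdot> ((rplus S (a \<cdot> b) \<cdot> a) \<cdot> d)"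
    by (simp add: ac car assoc proj_left_comm)
  \<comment> \<open>The ample identity is used twice: here to bring \<open>b\<^sup>+\<close> next to
    \<open>d\<close>, and after the exchange of \<open>b\<^sup>+ d\<close> for
    \<open>d\<^sup>+ b\<close> to move \<open>d\<^sup>+\<close> to the left of
    \<open>a\<close>.\<close>
  also have "\<dots> = rplus S c \<cdot> ((a \<cdot> rplus S b) \<cdot> d)"
    by (simp add: car plus_ample)
  also have "\<dots> = rplus S c \<cdot> ((a \<cdot> rplus S d) \<cdot> b)"
    by (simp add: car bd assoc)
  also have "\<dots> = (rplus S c \<cdot> rplus S (a \<cdot> d)) \<cdot> (a \<cdot> b)"
    unfolding plus_ample[OF car(1,4)] by (simp add: car assoc)
  \<comment> \<open>The remaining coefficient becomes \<open>(c d)\<^sup>+ a\<^sup>+\<close> by the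
    compatibility of \<open>a\<close> and \<open>c\<close>, and its last factor is swallowed by
    \<open>a\<close>.\<close>
  also have "rplus S c \<cdot> rplus S (a \<cdot> d) = rplus S ((rplus S c \<cdot> a) \<cdot> d)"
    by (simp add: car assoc)
  also have "\<dots> = rplus S (c \<cdot> d) \<cdot> rplus S a"
    by (simp add: car ac[symmetric] assoc plus_comm)
  also have "\<dots> \<cdot> (a \<cdot> b) = rplus S (c \<cdot> d) \<cdot> ((rplus S a \<cdot> a) \<cdot> b)"
    using car by (simp add: assoc)
  also have "rplus S a \<cdot> a = a"
    by (simp add: car plus_left_id)
  finally show ?thesis .
qed

end

section \<open>Left-right duality and products of permissible subsets\<close>

definition opposite :: "('a, 'm) rsemigroup_scheme \<Rightarrow> 'a rsemigroup" where
  "opposite S = \<lparr>carrier = carrier S, rmult = (\<lambda>x y. y \<cdot>\<^bsub>S\<^esub> x), rplus = rstar S, rstar = rplus S\<rparr>"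

lemma opposite_simps [simp]:
  "carrier (opposite S) = carrier S" "x \<cdot>\<^bsub>opposite S\<^esub> y = y \<cdot>\<^bsub>S\<^esub> x"
  "rplus (opposite S) = rstar S" "rstar (opposite S) = rplus S"
  by (simp_all add: opposite_def)

context restriction_semigroup
begin

text \<open>The axioms come in dual pairs, so a result about plus, read in the opposite semigroup,
  is a result about star with all products reversed.\<close>

lemma restriction_semigroup_opposite: "restriction_semigroup (opposite S)"
proof unfold_locales
  fix x y z
  show "carrier (opposite S) \<noteq> {}" using nonempty by simp
  assume x: "x \<in> carrier (opposite S)"
  show "rplus (opposite S) x \<in> carrier (opposite S)" "rstar (opposite S) x \<in> carrier (opposite S)"
    "rplus (opposite S) x \<cdot>\<^bsub>opposite S\<^esub> x = x" "x \<cdot>\<^bsub>opposite S\<^esub> rstar (opposite S) x = x"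
    "rstar (opposite S) (rplus (opposite S) x) = rplus (opposite S) x"
    "rplus (opposite S) (rstar (opposite S) x) = rstar (opposite S) x"
    using x by (simp_all add: plus_left_id star_right_id)
  assume y: "y \<in> carrier (opposite S)"
  show "x \<cdot>\<^bsub>opposite S\<^esub> y \<in> carrier (opposite S)"
    "rplus (opposite S) (rplus (opposite S) x \<cdot>\<^bsub>opposite S\<^esub> y) =
      rplus (opposite S) x \<cdot>\<^bsub>opposite S\<^esub> rplus (opposite S) y"
    "rstar (opposite S) (y \<cdot>\<^bsub>opposite S\<^esub> rstar (opposite S) x) =
      rstar (opposite S) y \<cdot>\<^bsub>opposite S\<^esub> rstar (opposite S) x"
    using x y by simp_all
  show "rplus (opposite S) x \<cdot>\<^bsub>opposite S\<^esub> rplus (opposite S) y =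
      rplus (opposite S) y \<cdot>\<^bsub>opposite S\<^esub> rplus (opposite S) x"
    "rstar (opposite S) y \<cdot>\<^bsub>opposite S\<^esub> rstar (opposite S) x =
      rstar (opposite S) x \<cdot>\<^bsub>opposite S\<^esub> rstar (opposite S) y"
    using x y by (simp_all add: proj_comm)
  show "x \<cdot>\<^bsub>opposite S\<^esub> rplus (opposite S) y =
      rplus (opposite S) (x \<cdot>\<^bsub>opposite S\<^esub> y) \<cdot>\<^bsub>opposite S\<^esub> x"
    using x y by (simp add: star_ample)
  show "rstar (opposite S) y \<cdot>\<^bsub>opposite S\<^esub> x =
      x \<cdot>\<^bsub>opposite S\<^esub> rstar (opposite S) (y \<cdot>\<^bsub>opposite S\<^esub> x)"
    using x y plus_ample by simp
  assume z: "z \<in> carrier (opposite S)"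
  show "x \<cdot>\<^bsub>opposite S\<^esub> y \<cdot>\<^bsub>opposite S\<^esub> z = x \<cdot>\<^bsub>opposite S\<^esub> (y \<cdot>\<^bsub>opposite S\<^esub> z)"
    using x y z by (simp add: assoc)
qed

lemmas mult_compatible_star =
  restriction_semigroup.mult_compatible_plus[OF restriction_semigroup_opposite, simplified]

lemma permissible_mult:
  assumes A: "permissible S A" and B: "permissible S B"
  shows "permissible S {a \<cdot> b | a b. a \<in> A \<and> b \<in> B}"
proof (rule permissibleI)
  show "{a \<cdot> b | a b. a \<in> A \<and> b \<in> B} \<subseteq> carrier S"
    using assms permissible_carrier by auto
  show "{a \<cdot> b | a b. a \<in> A \<and> b \<in> B} \<noteq> {}"
    using permissible_nonempty[OF A] permissible_nonempty[OF B] by blast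
  show "e \<cdot> x \<in> {a \<cdot> b | a b. a \<in> A \<and> b \<in> B}"
    if "x \<in> {a \<cdot> b | a b. a \<in> A \<and> b \<in> B}" "e \<in> projections S" for x e
  proof -
    obtain a b where "a \<in> A" "b \<in> B" "x = a \<cdot> b" using \<open>x \<in> _\<close> by blast
    then show ?thesis
      using assms \<open>e \<in> _\<close> permissible_proj_mult[OF A]
      by (metis (mono_tags, lifting) assoc mem_Collect_eq permissible_carrier proj_closed)
  qed
  show "rplus S x \<cdot> y = rplus S y \<cdot> x"
    if xy: "x \<in> {a \<cdot> b | a b. a \<in> A \<and> b \<in> B}" "y \<in> {a \<cdot> b | a b. a \<in> A \<and> b \<in> B}" for x y
  proof -
    obtain a b c d where "a \<in> A" "b \<in> B" "x = a \<cdot> b" "c \<in> A" "d \<in> B" "y = c \<cdot> d"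
      using xy by blast
    then show ?thesis
      using mult_compatible_plus[of a b c d] permissible_carrier[OF A] permissible_carrier[OF B]
        permissible_plus[OF A, of a c] permissible_plus[OF B, of b d]
      by simp
  qed
  show "x \<cdot> rstar S y = y \<cdot> rstar S x"
    if xy: "x \<in> {a \<cdot> b | a b. a \<in> A \<and> b \<in> B}" "y \<in> {a \<cdot> b | a b. a \<in> A \<and> b \<in> B}" for x y
  proof -
    obtain a b c d where "a \<in> A" "b \<in> B" "x = a \<cdot> b" "c \<in> A" "d \<in> B" "y = c \<cdot> d"
      using xy by blast
    \<comment> \<open>The arguments are swapped within each pair because the opposite semigroup
      reverses products.\<close>
    then show ?thesis
      using mult_compatible_star[of b a d c] permissible_carrier[OF A] permissible_carrier[OF B]
        permissible_star[OF A, of a c] permissible_star[OF B, of b d]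
      by simp
  qed
qed

end

lemma permissible_monoid_simps [simp]:
  "carrier (permissible_monoid S) = {A. permissible S A}"
  "A \<cdot>\<^bsub>permissible_monoid S\<^esub> B = {a \<cdot>\<^bsub>S\<^esub> b | a b. a \<in> A \<and> b \<in> B}"
  "rplus (permissible_monoid S) A = rplus S ` A"
  "rstar (permissible_monoid S) A = rstar S ` A"
  "rone (permissible_monoid S) = projections S"
  by (simp_all add: permissible_monoid_def)

context restriction_semigroup
begin

lemma permissible_plus_left_id:
  assumes A: "permissible S A"
  shows "{a \<cdot> b | a b. a \<in> rplus S ` A \<and> b \<in> A} = A"
proof (intro equalityI subsetI)
  fix x assume "x \<in> A"
  then show "x \<in> {a \<cdot> b | a b. a \<in> rplus S ` A \<and> b \<in> A}"
    using plus_left_id[OF permissible_carrier[OF A], symmetric] by blast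
qed (use permissible_proj_mult[OF A] permissible_carrier[OF A] in auto)

lemma permissible_star_right_id:
  assumes A: "permissible S A"
  shows "{a \<cdot> b | a b. a \<in> A \<and> b \<in> rstar S ` A} = A"
proof (intro equalityI subsetI)
  fix x assume "x \<in> A"
  then show "x \<in> {a \<cdot> b | a b. a \<in> A \<and> b \<in> rstar S ` A}"
    using star_right_id[OF permissible_carrier[OF A], symmetric] by blast
qed (use permissible_mult_proj[OF A] permissible_carrier[OF A] in auto)

text \<open>The ample identity of \<open>S\<close>, applied elementwise, gives only one inclusion.
  On the right-hand side \<open>a\<close> and \<open>c\<close> vary independently in
  \<open>A\<close>, and compatibility has to bring them together.\<close>

lemma permissible_plus_ample:
  assumes A: "permissible S A" and B: "permissible S B"
  shows "{a \<cdot> f | a f. a \<in> A \<and> f \<in> rplus S ` B} =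
    {e \<cdot> c | e c. e \<in> rplus S ` {a \<cdot> b | a b. a \<in> A \<and> b \<in> B} \<and> c \<in> A}"
proof (intro equalityI subsetI)
  fix x assume "x \<in> {a \<cdot> f | a f. a \<in> A \<and> f \<in> rplus S ` B}"
  then obtain a b where ab: "a \<in> A" "b \<in> B" "x = a \<cdot> rplus S b" by blast
  then have "x = rplus S (a \<cdot> b) \<cdot> a"
    using plus_ample permissible_carrier[OF A] permissible_carrier[OF B] by auto
  with ab show "x \<in> {e \<cdot> c | e c. e \<in> rplus S ` {a \<cdot> b | a b. a \<in> A \<and> b \<in> B} \<and> c \<in> A}" by blast
next
  fix x assume "x \<in> {e \<cdot> c | e c. e \<in> rplus S ` {a \<cdot> b | a b. a \<in> A \<and> b \<in> B} \<and> c \<in> A}"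
  then obtain a b c where abc: "a \<in> A" "b \<in> B" "c \<in> A" "x = rplus S (a \<cdot> b) \<cdot> c" by blast
  have car: "a \<in> carrier S" "b \<in> carrier S" "c \<in> carrier S"
    using abc permissible_carrier A B by auto
  note ab = plus_mult_absorb[OF car(1,2), symmetric]
  have "x = rplus S (a \<cdot> b) \<cdot> (rplus S a \<cdot> c)"
    unfolding abc by (subst ab) (simp add: car assoc)
  \<comment> \<open>Exchanging \<open>a\<^sup>+ c\<close> for \<open>c\<^sup>+ a\<close> puts
    \<open>a\<close> next to \<open>(a b)\<^sup>+\<close>, where the ample identity applies; the
    left factor \<open>c\<^sup>+ a\<close> that results is again in \<open>A\<close>.\<close>
  also have "\<dots> = rplus S c \<cdot> (rplus S (a \<cdot> b) \<cdot> a)"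
    using permissible_plus[OF A, of a c] abc car by (simp add: proj_left_comm)
  also have "\<dots> = (rplus S c \<cdot> a) \<cdot> rplus S b"
    using car by (simp add: plus_ample[OF car(1,2), symmetric] assoc)
  finally show "x \<in> {a \<cdot> f | a f. a \<in> A \<and> f \<in> rplus S ` B}"
    using permissible_proj_mult[OF A, of "rplus S c" a] abc car by auto
qed

text \<open>\<open>projections\<close> is defined through plus alone. The images of the two unary
  operations agree because every star is a projection and every projection is its own star.\<close>

lemma projections_opposite: "projections (opposite S) = projections S"
proof
  show "projections (opposite S) \<subseteq> projections S"
    unfolding projections_def[of "opposite S"] using star_proj by auto
  show "projections S \<subseteq> projections (opposite S)"
    unfolding projections_def[of "opposite S"]
    by (metis image_eqI opposite_simps(1,3) proj_closed star_of_proj subsetI)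
qed

text \<open>Duality turns left multiples into right multiples, so the ideal property required here
  is \<open>permissible_mult_proj\<close>.\<close>

lemma permissible_opposite:
  assumes A: "permissible S A"
  shows "permissible (opposite S) A"
  using permissible_carrier[OF A] permissible_nonempty[OF A] permissible_mult_proj[OF A]
    permissible_plus[OF A] permissible_star[OF A]
  by (intro restriction_semigroup.permissibleI[OF restriction_semigroup_opposite])
    (simp_all add: projections_opposite subset_iff)

lemma permissible_star_ample:
  assumes A: "permissible S A" and B: "permissible S B"
  shows "{f \<cdot> a | f a. f \<in> rstar S ` B \<and> a \<in> A} =
    {c \<cdot> e | c e. c \<in> A \<and> e \<in> rstar S ` {b \<cdot> a | b a. b \<in> B \<and> a \<in> A}}"
proof -
  have "{f \<cdot> a | f a. f \<in> rstar S ` B \<and> a \<in> A} =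
      {a \<cdot>\<^bsub>opposite S\<^esub> f | a f. a \<in> A \<and> f \<in> rplus (opposite S) ` B}"
    unfolding opposite_simps by blast
  also have "\<dots> = {e \<cdot>\<^bsub>opposite S\<^esub> c | e c.
      e \<in> rplus (opposite S) ` {a \<cdot>\<^bsub>opposite S\<^esub> b | a b. a \<in> A \<and> b \<in> B} \<and> c \<in> A}"
    by (rule restriction_semigroup.permissible_plus_ample
        [OF restriction_semigroup_opposite permissible_opposite[OF A] permissible_opposite[OF B]])
  also have "{a \<cdot>\<^bsub>opposite S\<^esub> b | a b. a \<in> A \<and> b \<in> B} = {b \<cdot> a | b a. b \<in> B \<and> a \<in> A}"
    unfolding opposite_simps by blast
  finally show ?thesis
    unfolding opposite_simps by blast
qed

text \<open>Closure under products and the two ample identities rest on compatibility. The remaining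
  axioms follow from the order ideal property or hold element by element.\<close>

theorem restriction_monoid_permissible_monoid: "restriction_monoid (permissible_monoid S)"
proof unfold_locales
  let ?C = "permissible_monoid S"
  fix A B C
  show "carrier ?C \<noteq> {}" using permissible_projections by auto
  show "rone ?C \<in> carrier ?C" using permissible_projections by auto
  assume A: "A \<in> carrier ?C"
  then have Ac: "\<And>a. a \<in> A \<Longrightarrow> a \<in> carrier S" using permissible_carrier by auto
  show "rplus ?C A \<in> carrier ?C" "rstar ?C A \<in> carrier ?C"
    using A by (simp_all add: permissible_image_plus permissible_image_star)
  show "rplus ?C A \<cdot>\<^bsub>?C\<^esub> A = A" "A \<cdot>\<^bsub>?C\<^esub> rstar ?C A = A"
    using A by (simp_all add: permissible_plus_left_id permissible_star_right_id)
  show "rstar ?C (rplus ?C A) = rplus ?C A" "rplus ?C (rstar ?C A) = rstar ?C A"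
    using Ac by (simp_all add: image_image)
  show "rone ?C \<cdot>\<^bsub>?C\<^esub> A = A"
  proof (intro equalityI subsetI)
    fix x assume "x \<in> A"
    then show "x \<in> rone ?C \<cdot>\<^bsub>?C\<^esub> A"
      using plus_left_id[OF Ac, symmetric] plus_proj[OF Ac] unfolding permissible_monoid_simps by blast
  qed (use A permissible_proj_mult in auto)
  show "A \<cdot>\<^bsub>?C\<^esub> rone ?C = A"
  proof (intro equalityI subsetI)
    fix x assume "x \<in> A"
    then show "x \<in> A \<cdot>\<^bsub>?C\<^esub> rone ?C"
      using star_right_id[OF Ac, symmetric] star_proj[OF Ac] unfolding permissible_monoid_simps by blast
  qed (use A permissible_mult_proj in auto)
  assume B: "B \<in> carrier ?C"
  then have Bc: "\<And>a. a \<in> B \<Longrightarrow> a \<in> carrier S" using permissible_carrier by auto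
  show "A \<cdot>\<^bsub>?C\<^esub> B \<in> carrier ?C"
    using A B by (simp add: permissible_mult)
  show "rplus ?C (rplus ?C A \<cdot>\<^bsub>?C\<^esub> B) = rplus ?C A \<cdot>\<^bsub>?C\<^esub> rplus ?C B"
    using Ac Bc by (force simp: image_iff)
  show "rstar ?C (B \<cdot>\<^bsub>?C\<^esub> rstar ?C A) = rstar ?C B \<cdot>\<^bsub>?C\<^esub> rstar ?C A"
    using Ac Bc by (force simp: image_iff)
  show "rplus ?C A \<cdot>\<^bsub>?C\<^esub> rplus ?C B = rplus ?C B \<cdot>\<^bsub>?C\<^esub> rplus ?C A"
    using Ac Bc plus_comm by fastforce
  show "rstar ?C B \<cdot>\<^bsub>?C\<^esub> rstar ?C A = rstar ?C A \<cdot>\<^bsub>?C\<^esub> rstar ?C B"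
    using Ac Bc star_comm by fastforce
  show "A \<cdot>\<^bsub>?C\<^esub> rplus ?C B = rplus ?C (A \<cdot>\<^bsub>?C\<^esub> B) \<cdot>\<^bsub>?C\<^esub> A"
    using A B permissible_plus_ample by simp
  show "rstar ?C B \<cdot>\<^bsub>?C\<^esub> A = A \<cdot>\<^bsub>?C\<^esub> rstar ?C (B \<cdot>\<^bsub>?C\<^esub> A)"
    using A B permissible_star_ample by simp
  assume C: "C \<in> carrier ?C"
  then have Cc: "\<And>a. a \<in> C \<Longrightarrow> a \<in> carrier S" using permissible_carrier by auto
  show "(A \<cdot>\<^bsub>?C\<^esub> B) \<cdot>\<^bsub>?C\<^esub> C = A \<cdot>\<^bsub>?C\<^esub> (B \<cdot>\<^bsub>?C\<^esub> C)"
  proof (intro equalityI subsetI)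
    fix x assume "x \<in> (A \<cdot>\<^bsub>?C\<^esub> B) \<cdot>\<^bsub>?C\<^esub> C"
    then obtain a b c where abc: "a \<in> A" "b \<in> B" "c \<in> C" and "x = (a \<cdot> b) \<cdot> c" by auto
    then have "x = a \<cdot> (b \<cdot> c)" using Ac Bc Cc assoc by simp
    with abc show "x \<in> A \<cdot>\<^bsub>?C\<^esub> (B \<cdot>\<^bsub>?C\<^esub> C)" by auto
  next
    fix x assume "x \<in> A \<cdot>\<^bsub>?C\<^esub> (B \<cdot>\<^bsub>?C\<^esub> C)"
    then obtain a b c where abc: "a \<in> A" "b \<in> B" "c \<in> C" and "x = a \<cdot> (b \<cdot> c)" by auto
    then have "x = (a \<cdot> b) \<cdot> c" using Ac Bc Cc assoc by simp
    with abc show "x \<in> (A \<cdot>\<^bsub>?C\<^esub> B) \<cdot>\<^bsub>?C\<^esub> C" by auto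
  qed
qed

end

section \<open>The Munn representation\<close>

context restriction_semigroup
begin

text \<open>Every element below \<open>a\<close> lies in \<open>A\<close>, so the partial maps \<open>munn S a\<close> with \<open>a \<in> A\<close>
  contribute nothing beyond the pairs \<open>(a\<^sup>+, a\<^sup>*)\<close> themselves.\<close>

lemma munn_ext_permissible:
  assumes A: "permissible S A"
  shows "munn_ext S A = {(rplus S a, rstar S a) | a. a \<in> A}"
proof (intro equalityI subsetI)
  fix p assume "p \<in> munn_ext S A"
  then obtain a e f where a: "a \<in> A" "e \<in> projections S" "f \<in> projections S"
    "e = f \<cdot> rplus S a" "p = (e, rstar S (e \<cdot> a))"
    unfolding munn_ext_def munn_def nat_le_def by blast
  have "a \<in> carrier S" using A a(1) by (rule permissible_carrier)
  then have "rplus S (e \<cdot> a) = e"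
    using a by (simp add: assoc)
  then show "p \<in> {(rplus S a, rstar S a) | a. a \<in> A}"
    using permissible_proj_mult[OF A a(2,1)] a(5) by (metis (mono_tags, lifting) mem_Collect_eq)
next
  fix p assume "p \<in> {(rplus S a, rstar S a) | a. a \<in> A}"
  then obtain a where a: "a \<in> A" "p = (rplus S a, rstar S a)" by blast
  have car: "a \<in> carrier S" using A a(1) by (rule permissible_carrier)
  have "nat_le S (rplus S a) (rplus S a)"
    unfolding nat_le_def using car by (metis plus_proj proj_idem)
  moreover have "rplus S a \<cdot> a = a" using car by (rule plus_left_id)
  ultimately have "p \<in> munn S a"
    unfolding munn_def using a(2) plus_proj[OF car] by (metis (mono_tags, lifting) mem_Collect_eq)
  then show "p \<in> munn_ext S A"
    unfolding munn_ext_def using a(1) by blast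
qed

lemma Domain_munn_ext: "permissible S A \<Longrightarrow> Domain (munn_ext S A) = rplus S ` A"
  by (auto simp: munn_ext_permissible)

lemma Range_munn_ext: "permissible S A \<Longrightarrow> Range (munn_ext S A) = rstar S ` A"
  by (auto simp: munn_ext_permissible)

text \<open>If \<open>a\<^sup>+ = b\<^sup>+\<close>, then
  \<open>b = a\<^sup>+ b = b\<^sup>+ a = a\<close>. Together with its dual this makes
  \<open>munn_ext S A\<close> the graph of a bijection, with \<open>A\<close> as a set of labels for
  its pairs.\<close>

lemma permissible_plus_inj:
  assumes "permissible S A" "a \<in> A" "b \<in> A" "rplus S a = rplus S b"
  shows "a = b"
  using assms by (metis permissible_carrier permissible_plus plus_left_id)

lemma permissible_star_inj:
  assumes "permissible S A" "a \<in> A" "b \<in> A" "rstar S a = rstar S b"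
  shows "a = b"
  using assms by (metis permissible_carrier permissible_star star_right_id)

lemma app_munn_ext:
  assumes "permissible S A" "a \<in> A"
  shows "app (munn_ext S A) (rplus S a) = rstar S a"
  unfolding app_def munn_ext_permissible[OF assms(1)]
  using assms permissible_plus_inj[OF assms(1)] by (intro the_equality) auto

lemma app_munn_ext_converse:
  assumes "permissible S A" "a \<in> A"
  shows "app ((munn_ext S A)\<inverse>) (rstar S a) = rplus S a"
  unfolding app_def munn_ext_permissible[OF assms(1)]
  using assms permissible_star_inj[OF assms(1)] by (intro the_equality) auto

lemma munn_ext_projections: "munn_ext S (projections S) = Id_on (projections S)"
  by (auto simp: munn_ext_permissible[OF permissible_projections])
    (metis plus_of_proj star_of_proj)

lemma munn_ext_mult:
  assumes A: "permissible S A" and B: "permissible S B"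
  shows "munn_ext S {a \<cdot> b | a b. a \<in> A \<and> b \<in> B} = munn_ext S A O munn_ext S B"
  unfolding munn_ext_permissible[OF A] munn_ext_permissible[OF B]
    munn_ext_permissible[OF permissible_mult[OF A B]]
proof (intro equalityI subsetI)
  fix p assume "p \<in> {(rplus S x, rstar S x) | x. x \<in> {a \<cdot> b | a b. a \<in> A \<and> b \<in> B}}"
  then obtain a b where ab: "a \<in> A" "b \<in> B" "p = (rplus S (a \<cdot> b), rstar S (a \<cdot> b))" by blast
  have car: "a \<in> carrier S" "b \<in> carrier S"
    using ab permissible_carrier A B by auto
  \<comment> \<open>Both factors are cut down to the meet of \<open>a\<^sup>*\<close> and
    \<open>b\<^sup>+\<close>. They stay in \<open>A\<close> and \<open>B\<close>, and the star of
    \<open>?c\<close> equals the plus of \<open>?d\<close>, so their pairs can be composed.\<close>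
  let ?c = "a \<cdot> rplus S b" and ?d = "rstar S a \<cdot> b"
  have "?c \<in> A" "?d \<in> B"
    using ab car by (simp_all add: permissible_mult_proj[OF A] permissible_proj_mult[OF B])
  then have c: "(rplus S ?c, rstar S ?c) \<in> {(rplus S a, rstar S a) | a. a \<in> A}"
    and d: "(rplus S ?d, rstar S ?d) \<in> {(rplus S b, rstar S b) | b. b \<in> B}"
    by blast+
  have eq: "rplus S ?c = rplus S (a \<cdot> b)" "rstar S ?d = rstar S (a \<cdot> b)"
    "rstar S ?c = rplus S ?d"
    using car by (simp_all add: plus_mult_plus star_mult_star)
  show "p \<in> {(rplus S a, rstar S a) | a. a \<in> A} O {(rplus S b, rstar S b) | b. b \<in> B}"
    unfolding ab(3) eq(1,2)[symmetric] by (rule relcompI[OF c d[folded eq(3)]])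
next
  fix p assume "p \<in> {(rplus S a, rstar S a) | a. a \<in> A} O {(rplus S b, rstar S b) | b. b \<in> B}"
  then obtain a b where ab: "a \<in> A" "b \<in> B" "rstar S a = rplus S b" "p = (rplus S a, rstar S b)"
    by auto
  have car: "a \<in> carrier S" "b \<in> carrier S"
    using ab permissible_carrier A B by auto
  \<comment> \<open>When \<open>a\<^sup>* = b\<^sup>+\<close> nothing is cut off: the plus of the
    product is that of \<open>a\<close> and its star is that of \<open>b\<close>.\<close>
  have "p = (rplus S (a \<cdot> b), rstar S (a \<cdot> b))"
    using plus_mult_plus[OF car] star_mult_star[OF car] plus_left_id[OF car(2)] star_right_id[OF car(1)]
      ab(3,4) by simp
  with ab show "p \<in> {(rplus S x, rstar S x) | x. x \<in> {a \<cdot> b | a b. a \<in> A \<and> b \<in> B}}"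
    by blast
qed

text \<open>Compatibility gives \<open>a\<^sup>+ b = a b\<^sup>*\<close>. The plus of this element
  is the meet of the two pluses, and its star is the meet of the two stars, which is why
  \<open>munn_ext S A\<close> preserves meets.\<close>

lemma permissible_meet_star:
  assumes A: "permissible S A" and a: "a \<in> A" and b: "b \<in> A"
  shows "rstar S (rplus S a \<cdot> b) = rstar S a \<cdot> rstar S b"
proof -
  have car: "a \<in> carrier S" "b \<in> carrier S"
    using a b permissible_carrier A by auto
  \<comment> \<open>This element is also \<open>b\<^sup>+ a\<close>, and therefore absorbs
    \<open>a\<^sup>*\<close> on the right.\<close>
  have "rplus S a \<cdot> b = rplus S a \<cdot> (b \<cdot> rstar S a)"
    using permissible_plus[OF A a b] car by (metis assoc plus_closed star_closed star_right_id)
  also have "\<dots> = (rplus S a \<cdot> a) \<cdot> rstar S b"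
    using permissible_star[OF A a b] car by (simp add: assoc)
  also have "\<dots> = a \<cdot> rstar S b"
    using car by (simp add: plus_left_id)
  finally show ?thesis
    using car by simp
qed

end

section \<open>The semilattice of projections and its ideal isomorphisms\<close>

definition projection_order :: "('a, 'm) rsemigroup_scheme \<Rightarrow> 'a gorder" where
  "projection_order S = \<lparr>carrier = projections S, eq = (=), le = nat_le S\<rparr>"

lemma projection_order_simps [simp]:
  "carrier (projection_order S) = projections S"
  "x .=\<^bsub>projection_order S\<^esub> y \<longleftrightarrow> x = y"
  "x \<sqsubseteq>\<^bsub>projection_order S\<^esub> y \<longleftrightarrow> nat_le S x y"
  by (simp_all add: projection_order_def)

context restriction_semigroup
begin

text \<open>Since \<open>f\<close> is idempotent, the witness for \<open>e \<le> f\<close> may be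
  taken to be \<open>e\<close> itself; the natural order on projections is thus the semilattice
  order.\<close>

lemma nat_le_projections:
  assumes "e \<in> projections S" "f \<in> projections S"
  shows "nat_le S e f \<longleftrightarrow> e = e \<cdot> f"
  unfolding nat_le_def using assms by (metis assoc proj_closed proj_idem)

lemma partial_order_projections: "partial_order (projection_order S)"
proof unfold_locales
  let ?P = "projection_order S"
  fix x y z assume x: "x \<in> carrier ?P" and y: "y \<in> carrier ?P"
  show "x \<sqsubseteq>\<^bsub>?P\<^esub> x" using x by (simp add: nat_le_projections)
  show "x .=\<^bsub>?P\<^esub> y" if "x \<sqsubseteq>\<^bsub>?P\<^esub> y" "y \<sqsubseteq>\<^bsub>?P\<^esub> x"
    using that x y unfolding projection_order_simps
    by (simp only: nat_le_projections) (metis proj_comm)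
  assume z: "z \<in> carrier ?P"
  show "x \<sqsubseteq>\<^bsub>?P\<^esub> z" if "x \<sqsubseteq>\<^bsub>?P\<^esub> y" "y \<sqsubseteq>\<^bsub>?P\<^esub> z"
    using that x y z unfolding projection_order_simps
    by (simp only: nat_le_projections) (metis assoc proj_closed)
qed (auto simp: fun_eq_iff)

lemma greatest_Lower_projections:
  assumes "e \<in> projections S" "f \<in> projections S"
  shows "greatest (projection_order S) (e \<cdot> f) (Lower (projection_order S) {e, f})"
proof -
  interpret partial_order "projection_order S" by (rule partial_order_projections)
  show ?thesis
  proof (rule greatest_LowerI)
    fix x assume "x \<in> {e, f}"
    then show "e \<cdot> f \<sqsubseteq>\<^bsub>projection_order S\<^esub> x"
      using assms by (auto simp: nat_le_def intro: proj_comm)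
  next
    fix y assume "y \<in> Lower (projection_order S) {e, f}"
    then have "y \<in> projections S" "nat_le S y e" "nat_le S y f"
      using assms by (auto simp: Lower_def)
    then have y: "y \<in> projections S" "y = y \<cdot> e" "y = y \<cdot> f"
      using assms by (simp_all only: nat_le_projections)
    then have "y = y \<cdot> (e \<cdot> f)"
      using assms by (metis assoc proj_closed)
    then show "y \<sqsubseteq>\<^bsub>projection_order S\<^esub> e \<cdot> f"
      using assms y(1) by (simp only: projection_order_simps nat_le_projections proj_mult)
  qed (use assms in auto)
qed

lemma lower_semilattice_projections: "lower_semilattice (projection_order S)"
proof -
  interpret partial_order "projection_order S" by (rule partial_order_projections)
  show ?thesis
    by unfold_locales (use greatest_Lower_projections in auto)
qed

text \<open>The meet of \<open>HOL-Algebra\<close> is given by a choice operator and is identified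
  through the uniqueness of greatest lower bounds.\<close>

lemma meet_projections:
  assumes "e \<in> projections S" "f \<in> projections S"
  shows "e \<sqinter>\<^bsub>projection_order S\<^esub> f = e \<cdot> f"
proof -
  interpret lower_semilattice "projection_order S" by (rule lower_semilattice_projections)
  have "greatest (projection_order S) (e \<sqinter>\<^bsub>projection_order S\<^esub> f) (Lower (projection_order S) {e, f})"
    unfolding meet_def using assms by (intro inf_of_two_greatest) auto
  then show ?thesis
    using greatest_Lower_projections[OF assms] by (rule greatest_unique)
qed

lemma semilat_ideal_projections:
  assumes "I \<subseteq> projections S" "permissible S I"
  shows "semilat_ideal (projection_order S) I"
  unfolding semilat_ideal_def
proof (intro conjI ballI impI)
  fix x y assume "y \<in> I" "x \<in> carrier (projection_order S)" "x \<sqsubseteq>\<^bsub>projection_order S\<^esub> y"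
  then show "x \<in> I"
    using assms permissible_proj_mult[OF assms(2)] by (auto simp: nat_le_def)
qed (use assms permissible_nonempty in auto)

lemma ideal_iso_munn_ext:
  assumes A: "permissible S A"
  shows "ideal_iso (projection_order S) (munn_ext S A)"
  unfolding ideal_iso_def
proof (intro conjI allI impI)
  show "single_valued (munn_ext S A)"
    using permissible_plus_inj[OF A] by (force simp: munn_ext_permissible[OF A] single_valued_def)
  show "single_valued ((munn_ext S A)\<inverse>)"
    using permissible_star_inj[OF A] by (force simp: munn_ext_permissible[OF A] single_valued_def)
  show "semilat_ideal (projection_order S) (Domain (munn_ext S A))"
    using permissible_image_plus[OF A] permissible_carrier[OF A]
    by (intro semilat_ideal_projections) (auto simp: Domain_munn_ext[OF A])
  show "semilat_ideal (projection_order S) (Range (munn_ext S A))"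
    using permissible_image_star[OF A] permissible_carrier[OF A]
    by (intro semilat_ideal_projections) (auto simp: Range_munn_ext[OF A])
  fix e f e' f' assume "(e, f) \<in> munn_ext S A" "(e', f') \<in> munn_ext S A"
  then obtain a b where a: "a \<in> A" "e = rplus S a" "f = rstar S a"
    and b: "b \<in> A" "e' = rplus S b" "f' = rstar S b"
    unfolding munn_ext_permissible[OF A] by blast
  have car: "a \<in> carrier S" "b \<in> carrier S"
    using a b permissible_carrier[OF A] by auto
  \<comment> \<open>The pair belonging to \<open>a\<^sup>+ b\<close> is the componentwise meet of
    the two given pairs.\<close>
  have c: "rplus S a \<cdot> b \<in> A"
    using b car by (intro permissible_proj_mult[OF A]) auto
  moreover have "e \<sqinter>\<^bsub>projection_order S\<^esub> e' = rplus S (rplus S a \<cdot> b)"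
    using a b car by (simp add: meet_projections)
  moreover have "f \<sqinter>\<^bsub>projection_order S\<^esub> f' = rstar S (rplus S a \<cdot> b)"
    using a b car by (simp add: meet_projections permissible_meet_star[OF A])
  ultimately show "(e \<sqinter>\<^bsub>projection_order S\<^esub> e', f \<sqinter>\<^bsub>projection_order S\<^esub> f') \<in> munn_ext S A"
    unfolding munn_ext_permissible[OF A] by auto
qed

end

section \<open>The classes of \<open>\<sigma>\<close>\<close>

context restriction_semigroup
begin

lemma sigmaI:
  "a \<in> carrier S \<Longrightarrow> b \<in> carrier S \<Longrightarrow> e \<in> projections S \<Longrightarrow> e \<cdot> a = e \<cdot> b \<Longrightarrow> (a, b) \<in> sigma S"
  by (auto simp: sigma_def)

lemma sigma_carrier: "(a, b) \<in> sigma S \<Longrightarrow> a \<in> carrier S \<and> b \<in> carrier S"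
  by (simp add: sigma_def)

lemma equiv_sigma: "equiv (carrier S) (sigma S)"
proof (rule equivI)
  show "sigma S \<subseteq> carrier S \<times> carrier S" by (auto simp: sigma_def)
  show "refl_on (carrier S) (sigma S)"
    using sigmaI plus_proj by (fastforce intro!: refl_onI)
  show "sym (sigma S)" by (auto simp: sigma_def sym_def) metis
  show "trans (sigma S)"
  proof (rule transI)
    fix a b c assume "(a, b) \<in> sigma S" "(b, c) \<in> sigma S"
    then obtain e f where car: "a \<in> carrier S" "b \<in> carrier S" "c \<in> carrier S"
      and ef: "e \<in> projections S" "f \<in> projections S" and eq: "e \<cdot> a = e \<cdot> b" "f \<cdot> b = f \<cdot> c"
      by (auto simp: sigma_def)
    have "(e \<cdot> f) \<cdot> a = f \<cdot> (e \<cdot> a)"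
      using car ef by (simp add: assoc proj_left_comm)
    also have "\<dots> = e \<cdot> (f \<cdot> b)"
      using car ef by (simp add: eq(1) proj_left_comm)
    also have "\<dots> = (e \<cdot> f) \<cdot> c"
      using car ef by (simp add: eq(2) assoc)
    finally show "(a, c) \<in> sigma S"
      using car ef by (intro sigmaI[of _ _ "e \<cdot> f"]) auto
  qed
qed

lemma sigma_proj_mult:
  assumes "e \<in> projections S" "a \<in> carrier S"
  shows "(a, e \<cdot> a) \<in> sigma S"
  using assms by (intro sigmaI[of _ _ e]) (simp_all flip: assoc)

text \<open>Each of \<open>a\<close> and \<open>b\<close> is related to a projection multiple of
  itself, and compatibility says that \<open>b\<^sup>+ a\<close> and \<open>a\<^sup>+ b\<close>
  coincide.\<close>

lemma permissible_sigma:
  assumes A: "permissible S A" and ab: "a \<in> A" "b \<in> A"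
  shows "(a, b) \<in> sigma S"
proof -
  have car: "a \<in> carrier S" "b \<in> carrier S"
    using ab permissible_carrier A by auto
  have "(a, rplus S b \<cdot> a) \<in> sigma S" "(b, rplus S a \<cdot> b) \<in> sigma S"
    using car by (simp_all add: sigma_proj_mult)
  then show ?thesis
    using permissible_plus[OF A ab] equiv_sigma by (metis equivE symE transE)
qed

lemma sigma_class_subset: "t \<in> carrier S // sigma S \<Longrightarrow> t \<subseteq> carrier S"
  using in_quotient_imp_subset[OF equiv_sigma] .

lemma sigma_class_nonempty: "t \<in> carrier S // sigma S \<Longrightarrow> t \<noteq> {}"
  using in_quotient_imp_non_empty[OF equiv_sigma] .

lemma sigma_class_closed: "t \<in> carrier S // sigma S \<Longrightarrow> a \<in> t \<Longrightarrow> (a, b) \<in> sigma S \<Longrightarrow> b \<in> t"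
  using in_quotient_imp_closed[OF equiv_sigma] .

lemma sigma_class_related: "t \<in> carrier S // sigma S \<Longrightarrow> a \<in> t \<Longrightarrow> b \<in> t \<Longrightarrow> (a, b) \<in> sigma S"
  using in_quotient_imp_in_rel[OF equiv_sigma] by simp

text \<open>The principal order ideal of \<open>s\<close>: a permissible subset containing
  \<open>s\<close>, available for every \<open>s\<close>, against which factorizations in
  \<open>C(S)\<close> can be tested.\<close>

lemma permissible_down:
  assumes s: "s \<in> carrier S"
  shows "permissible S {e \<cdot> s | e. e \<in> projections S}"
proof -
  let ?D = "{e \<cdot> s | e. e \<in> projections S}"
  have "rplus S (e \<cdot> s) \<cdot> (f \<cdot> s) = rplus S (f \<cdot> s) \<cdot> (e \<cdot> s)"
    if "e \<in> projections S" "f \<in> projections S" for e f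
    using s that by (simp add: assoc proj_left_comm)
  moreover have "(e \<cdot> s) \<cdot> rstar S (f \<cdot> s) = (f \<cdot> s) \<cdot> rstar S (e \<cdot> s)"
    if "e \<in> projections S" "f \<in> projections S" for e f
  proof -
    \<comment> \<open>By the dual ample identity, \<open>s\<close> times the star of
      \<open>f s\<close> is \<open>f s\<close>.\<close>
    have "(e \<cdot> s) \<cdot> rstar S (f \<cdot> s) = e \<cdot> (f \<cdot> s)"
      using s that by (simp add: assoc flip: proj_mult_star)
    moreover have "(f \<cdot> s) \<cdot> rstar S (e \<cdot> s) = f \<cdot> (e \<cdot> s)"
      using s that by (simp add: assoc flip: proj_mult_star)
    ultimately show ?thesis
      using s that by (simp add: proj_left_comm)
  qed
  moreover have "f \<cdot> x \<in> ?D" if x: "x \<in> ?D" and f: "f \<in> projections S" for x f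
  proof -
    obtain e where "e \<in> projections S" "x = e \<cdot> s" using x by blast
    then have "f \<cdot> x = (f \<cdot> e) \<cdot> s" "f \<cdot> e \<in> projections S"
      using f s by (simp_all add: assoc)
    then show ?thesis by blast
  qed
  moreover have "?D \<subseteq> carrier S" "?D \<noteq> {}"
    using s projections_nonempty by auto
  ultimately show ?thesis
    by (intro permissibleI) blast+
qed

lemma mem_down: "s \<in> carrier S \<Longrightarrow> s \<in> {e \<cdot> s | e. e \<in> projections S}"
  using plus_left_id[of s, symmetric] plus_proj[of s] by blast

end

section \<open>Properness and \<sigma>-classes as permissible subsets\<close>

locale proper_restriction_semigroup = restriction_semigroup +
  assumes proper: "proper S"
begin

lemma sigma_plus_eq:
  assumes "(a, b) \<in> sigma S" "rplus S a = rplus S b"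
  shows "a = b"
proof -
  have "(a, b) \<in> R_rel S \<inter> sigma S"
    using assms sigma_carrier by (auto simp: R_rel_def)
  then have "(a, b) \<in> Id_on (carrier S)"
    using proper unfolding proper_def by metis
  then show ?thesis by auto
qed

lemma sigma_star_eq:
  assumes "(a, b) \<in> sigma S" "rstar S a = rstar S b"
  shows "a = b"
proof -
  have "(a, b) \<in> L_rel S \<inter> sigma S"
    using assms sigma_carrier by (auto simp: L_rel_def)
  then have "(a, b) \<in> Id_on (carrier S)"
    using proper unfolding proper_def by metis
  then show ?thesis by auto
qed

text \<open>For \<open>a\<close> and \<open>b\<close> in the class, \<open>a\<^sup>+ b\<close> and
  \<open>b\<^sup>+ a\<close> lie in the class too and both have plus
  \<open>a\<^sup>+ b\<^sup>+\<close>, so properness identifies them. The star condition is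
  dual.\<close>

lemma permissible_sigma_class:
  assumes t: "t \<in> carrier S // sigma S"
  shows "permissible S t"
proof (rule permissibleI)
  have car: "a \<in> carrier S" if "a \<in> t" for a
    using that sigma_class_subset[OF t] by auto
  then show "t \<subseteq> carrier S" by auto
  show "t \<noteq> {}" using t by (rule sigma_class_nonempty)
  show left: "e \<cdot> a \<in> t" if "a \<in> t" "e \<in> projections S" for a e
    using sigma_class_closed[OF t \<open>a \<in> t\<close>] sigma_proj_mult that car by auto
  have right: "a \<cdot> e \<in> t" if "a \<in> t" "e \<in> projections S" for a e
    using left[OF that(1), of "rplus S (a \<cdot> e)"] mult_proj[OF that(2) car[OF that(1)]] car that
    by (metis mult_closed plus_proj proj_closed)
  show "rplus S a \<cdot> b = rplus S b \<cdot> a" if "a \<in> t" "b \<in> t" for a b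
    by (rule sigma_plus_eq[OF sigma_class_related[OF t]])
      (use that car left in \<open>simp_all add: plus_comm\<close>)
  show "a \<cdot> rstar S b = b \<cdot> rstar S a" if "a \<in> t" "b \<in> t" for a b
    by (rule sigma_star_eq[OF sigma_class_related[OF t]])
      (use that car right in \<open>simp_all add: star_comm\<close>)
qed

lemma permissible_subset_sigma_class:
  assumes "permissible S A"
  obtains t where "t \<in> carrier S // sigma S" "A \<subseteq> t"
proof -
  obtain a where a: "a \<in> A" using permissible_nonempty[OF assms] by auto
  have "sigma S `` {a} \<in> carrier S // sigma S"
    using a permissible_carrier[OF assms] by (intro quotientI) auto
  moreover have "A \<subseteq> sigma S `` {a}"
    using permissible_sigma[OF assms a] by auto
  ultimately show ?thesis by (rule that)
qed

text \<open>\<open>A\<close> lies in a single \<sigma>-class. Every \<open>x\<close> of that class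
  shares its plus with some \<open>a\<close> in \<open>A\<close>, and properness forces
  \<open>x = a\<close>, so \<open>A\<close> exhausts the class.\<close>

lemma permissible_plus_full:
  assumes A: "permissible S A" and full: "rplus S ` A = projections S"
  shows "A \<in> carrier S // sigma S"
proof -
  obtain t where t: "t \<in> carrier S // sigma S" and sub: "A \<subseteq> t"
    using permissible_subset_sigma_class[OF A] .
  have "x \<in> A" if x: "x \<in> t" for x
  proof -
    have "rplus S x \<in> rplus S ` A"
      using x sigma_class_subset[OF t] by (auto simp: full)
    then obtain a where a: "a \<in> A" "rplus S x = rplus S a" by auto
    then have "x = a"
      using sub by (intro sigma_plus_eq[OF sigma_class_related[OF t x]]) auto
    with a(1) show ?thesis by simp
  qed
  with sub have "A = t" by auto
  with t show ?thesis by simp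
qed

lemma permissible_star_full:
  assumes A: "permissible S A" and full: "rstar S ` A = projections S"
  shows "A \<in> carrier S // sigma S"
proof -
  obtain t where t: "t \<in> carrier S // sigma S" and sub: "A \<subseteq> t"
    using permissible_subset_sigma_class[OF A] .
  have "x \<in> A" if x: "x \<in> t" for x
  proof -
    have "rstar S x \<in> rstar S ` A"
      using x sigma_class_subset[OF t] by (auto simp: full)
    then obtain a where a: "a \<in> A" "rstar S x = rstar S a" by auto
    then have "x = a"
      using sub by (intro sigma_star_eq[OF sigma_class_related[OF t x]]) auto
    with a(1) show ?thesis by simp
  qed
  with sub have "A = t" by auto
  with t show ?thesis by simp
qed

lemma image_plus_projections: "rplus S ` projections S = projections S"
  by (simp add: image_def)

lemma image_star_projections: "rstar S ` projections S = projections S"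
  by (simp add: image_def)

text \<open>Being \<R>-related to the identity means that \<open>rplus S\<close> maps
  \<open>A\<close> onto all projections. This makes \<open>A\<close> a \<sigma>-class, and the image
  is the domain of \<open>munn_ext S A\<close>.\<close>

lemma R_class_one_permissible_monoid:
  "R_class_one (permissible_monoid S) = {t \<in> carrier S // sigma S. Domain (munn_ext S t) = projections S}"
proof -
  have mem: "A \<in> R_class_one (permissible_monoid S) \<longleftrightarrow> permissible S A \<and> rplus S ` A = projections S" for A
    using permissible_projections
    by (auto simp: R_class_one_def R_rel_def image_plus_projections)
  have "A \<in> R_class_one (permissible_monoid S) \<longleftrightarrow>
      A \<in> carrier S // sigma S \<and> Domain (munn_ext S A) = projections S" for A
    using mem permissible_sigma_class permissible_plus_full Domain_munn_ext by metis
  then show ?thesis by blast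
qed

lemma L_class_one_permissible_monoid:
  "L_class_one (permissible_monoid S) = {t \<in> carrier S // sigma S. Range (munn_ext S t) = projections S}"
proof -
  have mem: "A \<in> L_class_one (permissible_monoid S) \<longleftrightarrow> permissible S A \<and> rstar S ` A = projections S" for A
    using permissible_projections
    by (auto simp: L_class_one_def L_rel_def image_star_projections)
  have "A \<in> L_class_one (permissible_monoid S) \<longleftrightarrow>
      A \<in> carrier S // sigma S \<and> Range (munn_ext S A) = projections S" for A
    using mem permissible_sigma_class permissible_star_full Range_munn_ext by metis
  then show ?thesis by blast
qed

end

section \<open>The classes of the identity as submonoids\<close>

lemma H_class_one_eq: "H_class_one M = R_class_one M \<inter> L_class_one M"
  by (auto simp: H_class_one_def R_class_one_def L_class_one_def H_rel_def)

context restriction_monoid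
begin

lemma plus_one: "rplus S (rone S) = rone S"
  by (metis one_closed one_right plus_closed plus_left_id)

lemma star_one: "rstar S (rone S) = rone S"
  by (metis one_closed one_left star_closed star_right_id)

text \<open>If \<open>x\<^sup>+\<close> and \<open>y\<^sup>+\<close> are the identity, then
  \<open>x y\<close> has the same plus as \<open>x y\<^sup>+ = x\<close>.\<close>

lemma submonoid_R_class_one: "submonoid (R_class_one S) (plain_monoid S)"
proof
  fix x y assume "x \<in> R_class_one S" "y \<in> R_class_one S"
  then have "x \<in> carrier S" "y \<in> carrier S" "rplus S x = rone S" "rplus S y = rone S"
    by (auto simp: R_class_one_def R_rel_def plus_one)
  then show "x \<otimes>\<^bsub>plain_monoid S\<^esub> y \<in> R_class_one S"
    using plus_mult_plus[of x y] one_closed one_right[of x]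
    by (simp add: R_class_one_def R_rel_def plus_one plain_monoid_def)
qed (auto simp: R_class_one_def R_rel_def plain_monoid_def one_closed)

lemma submonoid_L_class_one: "submonoid (L_class_one S) (plain_monoid S)"
proof
  fix x y assume "x \<in> L_class_one S" "y \<in> L_class_one S"
  then have "x \<in> carrier S" "y \<in> carrier S" "rstar S x = rone S" "rstar S y = rone S"
    by (auto simp: L_class_one_def L_rel_def star_one)
  then show "x \<otimes>\<^bsub>plain_monoid S\<^esub> y \<in> L_class_one S"
    using star_mult_star[of x y] one_closed one_left[of y]
    by (simp add: L_class_one_def L_rel_def star_one plain_monoid_def)
qed (auto simp: L_class_one_def L_rel_def plain_monoid_def one_closed)

lemma submonoid_H_class_one: "submonoid (H_class_one S) (plain_monoid S)"
proof -
  interpret R: submonoid "R_class_one S" "plain_monoid S" by (rule submonoid_R_class_one)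
  interpret L: submonoid "L_class_one S" "plain_monoid S" by (rule submonoid_L_class_one)
  show ?thesis
    by unfold_locales (use R.subset in \<open>auto simp: H_class_one_eq\<close>)
qed

lemma monoid_plain_monoid: "monoid (plain_monoid S)"
  by unfold_locales (auto simp: plain_monoid_def assoc one_closed one_left one_right)

end

section \<open>Almost factorizability and almost \<open>T\<close>-properness\<close>

context proper_restriction_semigroup
begin

text \<open>The three cases of the theorem differ only in the submonoid \<open>T\<close>; in each of them
  both conditions say that \<open>T\<close> consists of all \<open>\<sigma>\<close>-classes.\<close>

lemma covered_iff_all_sigma_classes:
  assumes T: "T \<subseteq> carrier S // sigma S"
  shows "(\<forall>s\<in>carrier S. \<exists>A\<in>T. s \<in> A) \<longleftrightarrow> T = carrier S // sigma S"
proof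
  assume cover: "\<forall>s\<in>carrier S. \<exists>A\<in>T. s \<in> A"
  have "t \<in> T" if t: "t \<in> carrier S // sigma S" for t
  proof -
    obtain s where s: "s \<in> t" using sigma_class_nonempty[OF t] by auto
    then obtain A where A: "A \<in> T" "s \<in> A" using cover sigma_class_subset[OF t] by blast
    then have "A = t"
      using s t T quotient_disj[OF equiv_sigma, of A t] by auto
    with A show ?thesis by simp
  qed
  with T show "T = carrier S // sigma S" by auto
next
  assume "T = carrier S // sigma S"
  then show "\<forall>s\<in>carrier S. \<exists>A\<in>T. s \<in> A"
    using Union_quotient[OF equiv_sigma] by auto
qed

text \<open>An equality \<open>E s = E t\<close> in \<open>C(S)\<close> yields elements with
  \<open>a\<^sup>+ x = f y\<close>, where \<open>x\<close> is in \<open>s\<close> and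
  \<open>y\<close> in \<open>t\<close>. Both \<open>x\<close> and \<open>y\<close> are
  \<sigma>-related to this common value, so the two classes meet.\<close>

lemma sigma_separates_classes:
  assumes s: "s \<in> carrier S // sigma S" and t: "t \<in> carrier S // sigma S"
    and st: "(s, t) \<in> sigma (permissible_monoid S)"
  shows "s = t"
proof -
  let ?C = "permissible_monoid S"
  obtain E where E: "E \<in> projections ?C" "E \<cdot>\<^bsub>?C\<^esub> s = E \<cdot>\<^bsub>?C\<^esub> t"
    using st by (auto simp: sigma_def)
  then obtain A where A: "permissible S A" "E = rplus S ` A"
    unfolding projections_def[of ?C] by auto
  obtain a x where a: "a \<in> A" and x: "x \<in> s"
    using permissible_nonempty[OF A(1)] sigma_class_nonempty[OF s] by auto
  then have "rplus S a \<cdot> x \<in> E \<cdot>\<^bsub>?C\<^esub> s" using A by auto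
  then obtain f y where fy: "f \<in> E" "y \<in> t" "rplus S a \<cdot> x = f \<cdot> y"
    unfolding E by auto
  have "(x, rplus S a \<cdot> x) \<in> sigma S"
    using a x sigma_class_subset[OF s] permissible_carrier[OF A(1)]
    by (intro sigma_proj_mult) auto
  moreover have "(y, f \<cdot> y) \<in> sigma S"
    using fy sigma_class_subset[OF t] permissible_carrier[OF A(1)] A(2)
    by (intro sigma_proj_mult) auto
  ultimately have "(x, y) \<in> sigma S"
    using fy(3) equiv_sigma by (metis equivE symE transE)
  then show ?thesis
    using quotient_eqI[OF equiv_sigma s t x fy(2)] by simp
qed

text \<open>Inside the permissible class \<open>t\<close>, compatibility turns
  \<open>a\<^sup>+ x\<close> into \<open>x\<^sup>+ a\<close>, which belongs to the order ideal
  \<open>A\<close>. So \<open>A\<close> is recovered from \<open>t\<close> by restriction to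
  \<open>A\<^sup>+\<close>.\<close>

lemma permissible_factorization:
  assumes A: "permissible S A" and t: "t \<in> carrier S // sigma S" and sub: "A \<subseteq> t"
  shows "{e \<cdot> x | e x. e \<in> rplus S ` A \<and> x \<in> t} = A"
proof (intro equalityI subsetI)
  fix y assume "y \<in> {e \<cdot> x | e x. e \<in> rplus S ` A \<and> x \<in> t}"
  then obtain a x where ax: "a \<in> A" "x \<in> t" "y = rplus S a \<cdot> x" by blast
  then have "y = rplus S x \<cdot> a"
    using permissible_plus[OF permissible_sigma_class[OF t], of a x] sub by auto
  then show "y \<in> A"
    using permissible_proj_mult[OF A] ax sigma_class_subset[OF t] by auto
next
  fix y assume "y \<in> A"
  then show "y \<in> {e \<cdot> x | e x. e \<in> rplus S ` A \<and> x \<in> t}"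
    using plus_left_id[OF permissible_carrier[OF A], of y, symmetric] sub by blast
qed

text \<open>Writing the principal order ideal of \<open>s\<close> as \<open>E t\<close> with
  \<open>t\<close> in \<open>T\<close> gives \<open>s = f x\<close> with \<open>f\<close> a
  projection and \<open>x\<close> in \<open>t\<close>, so \<open>s\<close> lies in \<open>t\<close>
  and \<open>T\<close> covers \<open>S\<close>. Conversely, each permissible subset is its plus
  image times the \<sigma>-class containing it.\<close>

lemma T_proper_iff_all_sigma_classes:
  assumes T: "T \<subseteq> carrier S // sigma S"
    and sub: "submonoid T (plain_monoid (permissible_monoid S))"
  shows "T_proper (permissible_monoid S) T \<longleftrightarrow> T = carrier S // sigma S"
proof
  let ?C = "permissible_monoid S"
  assume "T_proper ?C T"
  then have fact: "carrier ?C = {E \<cdot>\<^bsub>?C\<^esub> t | E t. E \<in> projections ?C \<and> t \<in> T}"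
    unfolding T_proper_def by (elim conjE)
  have "\<exists>A\<in>T. s \<in> A" if s: "s \<in> carrier S" for s
  proof -
    have "{e \<cdot> s | e. e \<in> projections S} \<in> carrier ?C"
      using permissible_down[OF s] by simp
    then have "{e \<cdot> s | e. e \<in> projections S} \<in> {E \<cdot>\<^bsub>?C\<^esub> t | E t. E \<in> projections ?C \<and> t \<in> T}"
      unfolding fact .
    then obtain E t where E: "E \<in> projections ?C" and t: "t \<in> T"
      and "{e \<cdot> s | e. e \<in> projections S} = E \<cdot>\<^bsub>?C\<^esub> t"
      by blast
    then have "s \<in> E \<cdot>\<^bsub>?C\<^esub> t"
      using mem_down[OF s] by simp
    then obtain f x where fx: "f \<in> E" "x \<in> t" "s = f \<cdot> x" by auto
    have "f \<in> projections S"
      using E fx(1) permissible_carrier plus_proj unfolding projections_def[of ?C] by auto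
    then have "s \<in> t"
      using t T fx permissible_proj_mult[OF permissible_sigma_class] by auto
    with t show ?thesis by auto
  qed
  then show "T = carrier S // sigma S"
    using covered_iff_all_sigma_classes[OF T] by simp
next
  let ?C = "permissible_monoid S"
  assume all: "T = carrier S // sigma S"
  interpret C: restriction_monoid ?C by (rule restriction_monoid_permissible_monoid)
  have "carrier ?C = {E \<cdot>\<^bsub>?C\<^esub> t | E t. E \<in> projections ?C \<and> t \<in> T}"
  proof (intro equalityI subsetI)
    fix A assume "A \<in> carrier ?C"
    then have A: "permissible S A" by simp
    obtain t where t: "t \<in> carrier S // sigma S" "A \<subseteq> t"
      using permissible_subset_sigma_class[OF A] .
    have "rplus ?C A \<cdot>\<^bsub>?C\<^esub> t = A"
      using permissible_factorization[OF A t] by simp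
    moreover have "rplus ?C A \<in> projections ?C"
      unfolding projections_def using \<open>A \<in> carrier ?C\<close> by (rule imageI)
    ultimately show "A \<in> {E \<cdot>\<^bsub>?C\<^esub> t | E t. E \<in> projections ?C \<and> t \<in> T}"
      using t(1) all by blast
  next
    fix A assume "A \<in> {E \<cdot>\<^bsub>?C\<^esub> t | E t. E \<in> projections ?C \<and> t \<in> T}"
    then obtain E t where "E \<in> projections ?C" "t \<in> T" "A = E \<cdot>\<^bsub>?C\<^esub> t" by blast
    moreover have "t \<in> carrier ?C" using \<open>t \<in> T\<close> all permissible_sigma_class by simp
    ultimately show "A \<in> carrier ?C"
      using C.mult_closed C.proj_closed by blast
  qed
  then show "T_proper ?C T"
    unfolding T_proper_def using sub all sigma_separates_classes C.restriction_monoid_axioms by blast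
qed

end

section \<open>Actions and the semigroups \<open>W(T, Y)\<close>\<close>

lemma app_eq: "single_valued \<phi> \<Longrightarrow> (e, f) \<in> \<phi> \<Longrightarrow> app \<phi> e = f"
  unfolding app_def by (blast dest: single_valuedD)

lemma W_simps:
  "carrier (W T Y \<alpha>) = {(t, app (\<alpha> t) e) | t e. t \<in> carrier T \<and> e \<in> Domain (\<alpha> t)}"
  "(t, a) \<cdot>\<^bsub>W T Y \<alpha>\<^esub> (u, b) =
    (t \<otimes>\<^bsub>T\<^esub> u, app (\<alpha> u) (a \<sqinter>\<^bsub>Y\<^esub> app ((\<alpha> u)\<inverse>) b))"
  "rplus (W T Y \<alpha>) (t, a) = (\<one>\<^bsub>T\<^esub>, app ((\<alpha> t)\<inverse>) a)"
  "rstar (W T Y \<alpha>) (t, a) = (\<one>\<^bsub>T\<^esub>, a)"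
  by (simp_all add: W_def)

section \<open>Representing \<open>S\<close> by its own \<sigma>-classes and projections\<close>

context proper_restriction_semigroup
begin

lemma munn_ext_monoidal_hom:
  assumes T: "T \<subseteq> carrier (permissible_monoid S)"
  shows "munn_ext S \<in> monoidal_hom ((plain_monoid (permissible_monoid S))\<lparr>carrier := T\<rparr>)
    (TI (projection_order S))"
  unfolding monoidal_hom_def hom_def TI_def plain_monoid_def
  using T ideal_iso_munn_ext munn_ext_mult
  by (auto simp: munn_ext_projections subset_iff)

text \<open>Properness makes \<open>?h\<close> injective, since an element is determined by its
  class and its star. The set product of two classes lies inside a class; the hypothesis
  \<open>sub\<close> makes it the whole class, as the multiplication of the first components
  demands.\<close>

lemma rsemigroup_iso_W:
  assumes sub: "submonoid (carrier S // sigma S) (plain_monoid (permissible_monoid S))"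
  shows "rsemigroup_iso S
    (W ((plain_monoid (permissible_monoid S))\<lparr>carrier := carrier S // sigma S\<rparr>)
      (projection_order S) (munn_ext S))"
proof -
  let ?C = "permissible_monoid S"
  let ?W = "W ((plain_monoid ?C)\<lparr>carrier := carrier S // sigma S\<rparr>) (projection_order S) (munn_ext S)"
  let ?h = "\<lambda>s. (sigma S `` {s}, rstar S s)"
  interpret T: submonoid "carrier S // sigma S" "plain_monoid ?C" by (rule sub)
  have cls: "sigma S `` {s} \<in> carrier S // sigma S" if "s \<in> carrier S" for s
    using that by (rule quotientI)
  have mem: "s \<in> sigma S `` {s}" if "s \<in> carrier S" for s
    using that by (rule equiv_class_self[OF equiv_sigma])
  have perm: "permissible S (sigma S `` {s})" if "s \<in> carrier S" for s
    using permissible_sigma_class[OF cls[OF that]] .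
  have cls_eq: "t = sigma S `` {s}" if t: "t \<in> carrier S // sigma S" "s \<in> t" for t s
  proof -
    have "s \<in> carrier S" using t sigma_class_subset by auto
    then show ?thesis
      using quotient_disj[OF equiv_sigma t(1) cls[of s]] mem[of s] t(2) by blast
  qed
  have inj: "inj_on ?h (carrier S)"
  proof (rule inj_onI)
    fix s r assume s: "s \<in> carrier S" and r: "r \<in> carrier S" and eq: "?h s = ?h r"
    then have "(s, r) \<in> sigma S" using mem[OF r] by auto
    with eq show "s = r" by (auto intro: sigma_star_eq)
  qed
  have "carrier ?W = ?h ` carrier S"
  proof (intro equalityI subsetI)
    fix w assume "w \<in> carrier ?W"
    then obtain t e where t: "t \<in> carrier S // sigma S" and e: "e \<in> Domain (munn_ext S t)"
      and w: "w = (t, app (munn_ext S t) e)"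
      by (auto simp: W_simps)
    obtain a where a: "a \<in> t" "e = rplus S a"
      using e Domain_munn_ext[OF permissible_sigma_class[OF t]] by auto
    then have "w = ?h a"
      using w cls_eq[OF t] app_munn_ext[OF permissible_sigma_class[OF t]] by auto
    then show "w \<in> ?h ` carrier S"
      using a sigma_class_subset[OF t] by auto
  next
    fix w assume "w \<in> ?h ` carrier S"
    then obtain s where s: "s \<in> carrier S" "w = ?h s" by auto
    have "?h s = (sigma S `` {s}, app (munn_ext S (sigma S `` {s})) (rplus S s))"
      using app_munn_ext[OF perm mem] s by simp
    moreover have "rplus S s \<in> Domain (munn_ext S (sigma S `` {s}))"
      using Domain_munn_ext[OF perm] mem s by auto
    ultimately show "w \<in> carrier ?W"
      unfolding W_simps s(2) using cls[OF s(1)] by auto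
  qed
  with inj have "bij_betw ?h (carrier S) (carrier ?W)"
    by (simp add: bij_betw_def)
  moreover have "?h (s \<cdot> r) = ?h s \<cdot>\<^bsub>?W\<^esub> ?h r" if s: "s \<in> carrier S" and r: "r \<in> carrier S" for s r
  proof -
    have "sigma S `` {s} \<cdot>\<^bsub>?C\<^esub> sigma S `` {r} \<in> carrier S // sigma S"
      using T.m_closed[OF cls[OF s] cls[OF r]] by (simp add: plain_monoid_def)
    moreover have "s \<cdot> r \<in> sigma S `` {s} \<cdot>\<^bsub>?C\<^esub> sigma S `` {r}"
      using mem s r by auto
    ultimately have fst: "sigma S `` {s} \<cdot>\<^bsub>?C\<^esub> sigma S `` {r} = sigma S `` {s \<cdot> r}"
      by (rule cls_eq)
    \<comment> \<open>The multiplication in \<open>W\<close> looks for the element of the class of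
      \<open>r\<close> whose plus is the meet of \<open>s\<^sup>*\<close> and
      \<open>r\<^sup>+\<close>. This is \<open>?d\<close>, and its star is that of
      \<open>s r\<close>.\<close>
    let ?d = "rstar S s \<cdot> r"
    have d: "?d \<in> sigma S `` {r}"
      using s r mem by (intro permissible_proj_mult[OF perm]) auto
    have "rstar S s \<sqinter>\<^bsub>projection_order S\<^esub> app ((munn_ext S (sigma S `` {r}))\<inverse>) (rstar S r) = rplus S ?d"
      using s r by (simp add: app_munn_ext_converse[OF perm mem] meet_projections)
    then have "app (munn_ext S (sigma S `` {r}))
        (rstar S s \<sqinter>\<^bsub>projection_order S\<^esub> app ((munn_ext S (sigma S `` {r}))\<inverse>) (rstar S r)) = rstar S (s \<cdot> r)"
      using app_munn_ext[OF perm[OF r] d] star_mult_star[OF s r] by simp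
    with fst show ?thesis
      by (simp add: W_simps plain_monoid_def)
  qed
  \<comment> \<open>The identity of the submonoid is the set of projections, which is thus a single
    \<sigma>-class and the first component of the image of every projection.\<close>
  moreover have "projections S \<in> carrier S // sigma S"
    using T.one_closed by (simp add: plain_monoid_def)
  then have one: "sigma S `` {e} = projections S" if "e \<in> projections S" for e
    using cls_eq that by auto
  have "?h (rplus S s) = rplus ?W (?h s)" if "s \<in> carrier S" for s
    using that one app_munn_ext_converse[OF perm mem] by (simp add: W_simps plain_monoid_def)
  moreover have "?h (rstar S s) = rstar ?W (?h s)" if "s \<in> carrier S" for s
    using that one by (simp add: W_simps plain_monoid_def)
  ultimately show ?thesis
    unfolding rsemigroup_iso_def by (intro exI[of _ ?h]) blast
qed

lemma iso_to_W_munn: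
  assumes sub: "submonoid (carrier S // sigma S) (plain_monoid (permissible_monoid S))"
    and cond: "cond (carrier S // sigma S) (projections S) (munn_ext S)"
  shows "iso_to_W TYPE('a set) TYPE('a) cond S"
proof -
  let ?C = "permissible_monoid S"
  let ?T = "(plain_monoid ?C)\<lparr>carrier := carrier S // sigma S\<rparr>"
  interpret C: restriction_monoid ?C by (rule restriction_monoid_permissible_monoid)
  have "monoid ?T"
    using submonoid.submonoid_is_monoid[OF sub C.monoid_plain_monoid] .
  moreover have "munn_ext S \<in> monoidal_hom ?T (TI (projection_order S))"
    using permissible_sigma_class by (intro munn_ext_monoidal_hom) auto
  ultimately show ?thesis
    unfolding iso_to_W_def
    using lower_semilattice_projections projections_nonempty cond rsemigroup_iso_W[OF sub]
    by (intro exI[of _ ?T] exI[of _ "projection_order S"] exI[of _ "munn_ext S"]) simp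
qed

end

section \<open>Ideal actions and isomorphisms onto \<open>W(T, Y)\<close>\<close>

locale ideal_action = T: monoid T + Y: lower_semilattice Y
  for T :: "('t, 'm) monoid_scheme" and Y :: "('y, 'n) gorder_scheme" and \<alpha> +
  assumes action: "\<alpha> \<in> monoidal_hom T (TI Y)"
begin

lemma action_ideal_iso: "t \<in> carrier T \<Longrightarrow> ideal_iso Y (\<alpha> t)"
  using action by (auto simp: monoidal_hom_def hom_def TI_def)

lemma action_one: "\<alpha> \<one>\<^bsub>T\<^esub> = Id_on (carrier Y)"
  using action by (auto simp: monoidal_hom_def TI_def)

lemma app_action: "t \<in> carrier T \<Longrightarrow> (e, f) \<in> \<alpha> t \<Longrightarrow> app (\<alpha> t) e = f"
  using action_ideal_iso by (auto simp: ideal_iso_def intro: app_eq)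

lemma app_action_converse: "t \<in> carrier T \<Longrightarrow> (e, f) \<in> \<alpha> t \<Longrightarrow> app ((\<alpha> t)\<inverse>) f = e"
  using action_ideal_iso by (auto simp: ideal_iso_def intro: app_eq)

lemma action_carrier:
  assumes t: "t \<in> carrier T" and ef: "(e, f) \<in> \<alpha> t"
  shows "e \<in> carrier Y \<and> f \<in> carrier Y"
proof -
  have "Domain (\<alpha> t) \<subseteq> carrier Y" "Range (\<alpha> t) \<subseteq> carrier Y"
    using action_ideal_iso[OF t] by (simp_all add: ideal_iso_def semilat_ideal_def)
  then show ?thesis using ef by auto
qed

lemma carrier_W: "(t, f) \<in> carrier (W T Y \<alpha>) \<longleftrightarrow> t \<in> carrier T \<and> (\<exists>e. (e, f) \<in> \<alpha> t)"
proof
  assume "(t, f) \<in> carrier (W T Y \<alpha>)"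
  then obtain e where t: "t \<in> carrier T" and e: "e \<in> Domain (\<alpha> t)" "f = app (\<alpha> t) e"
    unfolding W_simps by blast
  then show "t \<in> carrier T \<and> (\<exists>e. (e, f) \<in> \<alpha> t)"
    using app_action[OF t] by auto
next
  assume "t \<in> carrier T \<and> (\<exists>e. (e, f) \<in> \<alpha> t)"
  then obtain e where t: "t \<in> carrier T" and e: "(e, f) \<in> \<alpha> t" by blast
  show "(t, f) \<in> carrier (W T Y \<alpha>)"
    unfolding W_simps using t e app_action[OF t e, symmetric] by blast
qed

lemma meet_absorb:
  assumes "x \<in> carrier Y" "y \<in> carrier Y"
  shows "(x \<sqinter>\<^bsub>Y\<^esub> y) \<sqinter>\<^bsub>Y\<^esub> x = x \<sqinter>\<^bsub>Y\<^esub> y" "(x \<sqinter>\<^bsub>Y\<^esub> y) \<sqinter>\<^bsub>Y\<^esub> y = x \<sqinter>\<^bsub>Y\<^esub> y"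
  using assms
  by (auto intro!: Y.le_antisym Y.meet_le Y.meet_left Y.meet_right)

text \<open>Multiplying on the left by \<open>(1, p)\<close> replaces the preimage of the second
  component by its meet with \<open>p\<close>. With \<open>p\<close> the meet of \<open>e\<close>
  and \<open>e'\<close>, both preimages become \<open>p\<close>.\<close>

lemma W_common_lower_bound:
  assumes t: "t \<in> carrier T" and ef: "(e, f) \<in> \<alpha> t" "(e', f') \<in> \<alpha> t"
  shows "(\<one>\<^bsub>T\<^esub>, e \<sqinter>\<^bsub>Y\<^esub> e') \<cdot>\<^bsub>W T Y \<alpha>\<^esub> (t, f) = (\<one>\<^bsub>T\<^esub>, e \<sqinter>\<^bsub>Y\<^esub> e') \<cdot>\<^bsub>W T Y \<alpha>\<^esub> (t, f')"
  using assms action_carrier[OF t] app_action_converse[OF t]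
  by (simp add: W_simps meet_absorb)

lemma W_one_carrier: "y \<in> carrier Y \<Longrightarrow> (\<one>\<^bsub>T\<^esub>, y) \<in> carrier (W T Y \<alpha>)"
  by (auto simp: carrier_W action_one)

lemma W_one_plus: "y \<in> carrier Y \<Longrightarrow> rplus (W T Y \<alpha>) (\<one>\<^bsub>T\<^esub>, y) = (\<one>\<^bsub>T\<^esub>, y)"
  using app_action_converse[of "\<one>\<^bsub>T\<^esub>" y y] by (auto simp: W_simps action_one)

end

text \<open>The isomorphism is fixed as \<open>h\<close>, so that computations with the formulas of
  \<open>W\<close> can be carried back to \<open>S\<close>, where the restriction semigroup laws
  hold by assumption.\<close>

locale isomorphic_to_W = restriction_semigroup S + ideal_action T Y \<alpha>
  for S :: "('a, 'k) rsemigroup_scheme" and T :: "('t, 'm) monoid_scheme"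
    and Y :: "('y, 'n) gorder_scheme" and \<alpha> +
  fixes h
  assumes bij: "bij_betw h (carrier S) (carrier (W T Y \<alpha>))"
    and h_mult: "x \<in> carrier S \<Longrightarrow> y \<in> carrier S \<Longrightarrow> h (x \<cdot>\<^bsub>S\<^esub> y) = h x \<cdot>\<^bsub>W T Y \<alpha>\<^esub> h y"
    and h_plus: "x \<in> carrier S \<Longrightarrow> h (rplus S x) = rplus (W T Y \<alpha>) (h x)"
    and h_star: "x \<in> carrier S \<Longrightarrow> h (rstar S x) = rstar (W T Y \<alpha>) (h x)"
begin

lemma h_inj: "x \<in> carrier S \<Longrightarrow> y \<in> carrier S \<Longrightarrow> h x = h y \<Longrightarrow> x = y"
  using bij by (auto simp: bij_betw_def inj_on_def)

lemma h_surj: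
  assumes "w \<in> carrier (W T Y \<alpha>)"
  obtains x where "x \<in> carrier S" "h x = w"
proof -
  have "w \<in> h ` carrier S"
    using assms bij_betw_imp_surj_on[OF bij] by simp
  then show ?thesis by (elim imageE) (simp add: that)
qed

lemma h_carrier: "x \<in> carrier S \<Longrightarrow> h x \<in> carrier (W T Y \<alpha>)"
  using bij by (auto simp: bij_betw_def)

text \<open>The preimage under \<open>h\<close> of the element equalizing \<open>(t, f)\<close> and
  \<open>(t, f')\<close> is a projection of \<open>S\<close>, and it equalizes \<open>x\<close> and
  \<open>x'\<close>.\<close>

lemma sigma_of_same_action:
  assumes x: "x \<in> carrier S" "h x = (t, f)" and x': "x' \<in> carrier S" "h x' = (t, f')"
  shows "(x, x') \<in> sigma S"
proof -
  obtain e e' where t: "t \<in> carrier T" and e: "(e, f) \<in> \<alpha> t" "(e', f') \<in> \<alpha> t"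
    using h_carrier[OF x(1)] h_carrier[OF x'(1)] x(2) x'(2) carrier_W by auto
  let ?p = "(\<one>\<^bsub>T\<^esub>, e \<sqinter>\<^bsub>Y\<^esub> e')"
  have meet: "e \<sqinter>\<^bsub>Y\<^esub> e' \<in> carrier Y"
    using e action_carrier[OF t] by auto
  obtain p where p: "p \<in> carrier S" "h p = ?p"
    using h_surj[OF W_one_carrier[OF meet]] .
  have "rplus S p = p"
    using p h_plus[OF p(1)] W_one_plus[OF meet] by (intro h_inj) auto
  then have "p \<in> projections S"
    using plus_proj[OF p(1)] by simp
  moreover have "p \<cdot>\<^bsub>S\<^esub> x = p \<cdot>\<^bsub>S\<^esub> x'"
    using p x x' W_common_lower_bound[OF t e] by (intro h_inj) (auto simp: h_mult)
  ultimately show ?thesis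
    using x x' by (intro sigmaI) auto
qed

lemma projection_image:
  assumes "e \<in> projections S"
  obtains y where "y \<in> carrier Y" "h e = (\<one>\<^bsub>T\<^esub>, y)"
proof -
  obtain t y where ty: "h e = (t, y)" by (cases "h e")
  then have t: "t \<in> carrier T" and "y \<in> carrier Y"
    using h_carrier[OF proj_closed[OF assms]] carrier_W action_carrier by auto
  moreover have "h e = rstar (W T Y \<alpha>) (h e)"
    using h_star[OF proj_closed[OF assms]] assms by simp
  ultimately show ?thesis
    using that[of y] ty by (simp add: W_simps)
qed

text \<open>Let \<open>e\<close> correspond to \<open>y\<close> in \<open>Y\<close> and
  \<open>x\<close> to a pair over \<open>t\<close>. Totality of \<open>\<alpha> t\<close> gives an
  image \<open>z\<close> of \<open>y\<close>, and the element corresponding to \<open>(t, z)\<close>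
  has plus \<open>e\<close> and lies in the \<sigma>-class of \<open>x\<close>.\<close>

lemma plus_full:
  assumes dom: "\<forall>t\<in>carrier T. Domain (\<alpha> t) = carrier Y"
    and x: "x \<in> carrier S" and e: "e \<in> projections S"
  shows "\<exists>x'. (x, x') \<in> sigma S \<and> rplus S x' = e"
proof -
  obtain t f where hx: "h x = (t, f)" by (cases "h x")
  then have t: "t \<in> carrier T"
    using h_carrier[OF x] carrier_W by auto
  obtain y where y: "y \<in> carrier Y" "h e = (\<one>\<^bsub>T\<^esub>, y)"
    using projection_image[OF e] .
  then obtain z where z: "(y, z) \<in> \<alpha> t"
    using dom t by blast
  then have "(t, z) \<in> carrier (W T Y \<alpha>)"
    using t carrier_W by auto
  then obtain x' where x': "x' \<in> carrier S" "h x' = (t, z)"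
    by (rule h_surj)
  have "h (rplus S x') = h e"
    using h_plus[OF x'(1)] x'(2) y(2) app_action_converse[OF t z] by (simp add: W_simps)
  then have "rplus S x' = e"
    using x'(1) e by (intro h_inj) auto
  then show ?thesis
    using sigma_of_same_action[OF x hx x'] by auto
qed

text \<open>Here \<open>(t, y)\<close> itself belongs to \<open>W\<close> as soon as
  \<open>y\<close> is in the range of \<open>\<alpha> t\<close>, and its star corresponds to
  \<open>e\<close>.\<close>

lemma star_full:
  assumes ran: "\<forall>t\<in>carrier T. Range (\<alpha> t) = carrier Y"
    and x: "x \<in> carrier S" and e: "e \<in> projections S"
  shows "\<exists>x'. (x, x') \<in> sigma S \<and> rstar S x' = e"
proof -
  obtain t f where hx: "h x = (t, f)" by (cases "h x")
  then have t: "t \<in> carrier T"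
    using h_carrier[OF x] carrier_W by auto
  obtain y where y: "y \<in> carrier Y" "h e = (\<one>\<^bsub>T\<^esub>, y)"
    using projection_image[OF e] .
  then have "(t, y) \<in> carrier (W T Y \<alpha>)"
    using ran t carrier_W by blast
  then obtain x' where x': "x' \<in> carrier S" "h x' = (t, y)"
    by (rule h_surj)
  have "h (rstar S x') = h e"
    using h_star[OF x'(1)] x'(2) y(2) by (simp add: W_simps)
  then have "rstar S x' = e"
    using x'(1) e by (intro h_inj) auto
  then show ?thesis
    using sigma_of_same_action[OF x hx x'] by auto
qed

end

section \<open>From a full action back to the Munn action\<close>

context proper_restriction_semigroup
begin

lemma iso_to_W_cases:
  assumes "iso_to_W TYPE('t) TYPE('y) cond S"
  obtains T :: "'t monoid" and Y :: "'y gorder" and \<alpha> h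
  where "isomorphic_to_W S T Y \<alpha> h" "cond (carrier T) (carrier Y) \<alpha>"
proof -
  obtain T :: "'t monoid" and Y :: "'y gorder" and \<alpha> h
    where "monoid T" "lower_semilattice Y" "\<alpha> \<in> monoidal_hom T (TI Y)"
      and cond: "cond (carrier T) (carrier Y) \<alpha>"
      and "bij_betw h (carrier S) (carrier (W T Y \<alpha>))"
      "\<forall>x\<in>carrier S. \<forall>y\<in>carrier S. h (x \<cdot> y) = h x \<cdot>\<^bsub>W T Y \<alpha>\<^esub> h y"
      "\<forall>x\<in>carrier S. h (rplus S x) = rplus (W T Y \<alpha>) (h x)"
      "\<forall>x\<in>carrier S. h (rstar S x) = rstar (W T Y \<alpha>) (h x)"
    using assms unfolding iso_to_W_def rsemigroup_iso_def by blast
  then have "isomorphic_to_W S T Y \<alpha> h"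
    by (intro isomorphic_to_W.intro ideal_action.intro ideal_action_axioms.intro
        isomorphic_to_W_axioms.intro restriction_semigroup_axioms) blast+
  then show ?thesis using cond by (rule that)
qed

lemma munn_domain_full:
  assumes W: "isomorphic_to_W S T Y \<alpha> h"
    and dom: "\<forall>t\<in>carrier T. Domain (\<alpha> t) = carrier Y" and c: "c \<in> carrier S // sigma S"
  shows "Domain (munn_ext S c) = projections S"
proof -
  interpret isomorphic_to_W S T Y \<alpha> h by (rule W)
  obtain x where x: "x \<in> c" using sigma_class_nonempty[OF c] by auto
  then have car: "x \<in> carrier S" using sigma_class_subset[OF c] by auto
  have "projections S \<subseteq> rplus S ` c"
  proof
    fix e assume "e \<in> projections S"
    then obtain x' where "(x, x') \<in> sigma S" "rplus S x' = e"
      using plus_full[OF dom car] by blast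
    then show "e \<in> rplus S ` c"
      using sigma_class_closed[OF c x] by blast
  qed
  moreover have "rplus S ` c \<subseteq> projections S"
    using sigma_class_subset[OF c] by auto
  ultimately show ?thesis
    unfolding Domain_munn_ext[OF permissible_sigma_class[OF c]] by (intro equalityI)
qed

lemma munn_range_full:
  assumes W: "isomorphic_to_W S T Y \<alpha> h"
    and ran: "\<forall>t\<in>carrier T. Range (\<alpha> t) = carrier Y" and c: "c \<in> carrier S // sigma S"
  shows "Range (munn_ext S c) = projections S"
proof -
  interpret isomorphic_to_W S T Y \<alpha> h by (rule W)
  obtain x where x: "x \<in> c" using sigma_class_nonempty[OF c] by auto
  then have car: "x \<in> carrier S" using sigma_class_subset[OF c] by auto
  have "projections S \<subseteq> rstar S ` c"
  proof
    fix e assume "e \<in> projections S"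
    then obtain x' where "(x, x') \<in> sigma S" "rstar S x' = e"
      using star_full[OF ran car] by blast
    then show "e \<in> rstar S ` c"
      using sigma_class_closed[OF c x] by blast
  qed
  moreover have "rstar S ` c \<subseteq> projections S"
    using sigma_class_subset[OF c] by auto
  ultimately show ?thesis
    unfolding Range_munn_ext[OF permissible_sigma_class[OF c]] by (intro equalityI)
qed

lemma endomorphisms_of_iso_to_W:
  assumes "iso_to_W TYPE('t) TYPE('y) acts_by_endomorphisms S"
  shows "acts_by_endomorphisms (carrier S // sigma S) (projections S) (munn_ext S)"
proof -
  obtain T :: "'t monoid" and Y :: "'y gorder" and \<alpha> h
    where "isomorphic_to_W S T Y \<alpha> h" "acts_by_endomorphisms (carrier T) (carrier Y) \<alpha>"
    using iso_to_W_cases[OF assms] .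
  then show ?thesis
    using munn_domain_full unfolding acts_by_endomorphisms_def by blast
qed

lemma onto_maps_of_iso_to_W:
  assumes "iso_to_W TYPE('t) TYPE('y) acts_by_onto_maps S"
  shows "acts_by_onto_maps (carrier S // sigma S) (projections S) (munn_ext S)"
proof -
  obtain T :: "'t monoid" and Y :: "'y gorder" and \<alpha> h
    where "isomorphic_to_W S T Y \<alpha> h" "acts_by_onto_maps (carrier T) (carrier Y) \<alpha>"
    using iso_to_W_cases[OF assms] .
  then show ?thesis
    using munn_range_full unfolding acts_by_onto_maps_def by blast
qed

lemma automorphisms_of_iso_to_W:
  assumes "iso_to_W TYPE('t) TYPE('y) acts_by_automorphisms S"
  shows "acts_by_automorphisms (carrier S // sigma S) (projections S) (munn_ext S)"
proof -
  obtain T :: "'t monoid" and Y :: "'y gorder" and \<alpha> h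
    where W: "isomorphic_to_W S T Y \<alpha> h" and "acts_by_automorphisms (carrier T) (carrier Y) \<alpha>"
    using iso_to_W_cases[OF assms] .
  then have "\<forall>t\<in>carrier T. Domain (\<alpha> t) = carrier Y" "\<forall>t\<in>carrier T. Range (\<alpha> t) = carrier Y"
    unfolding acts_by_automorphisms_def by blast+
  then show ?thesis
    unfolding acts_by_automorphisms_def using munn_domain_full[OF W] munn_range_full[OF W] by blast
qed

text \<open>The pattern shared by the three cases. \<open>cond\<close> and \<open>cond'\<close>
  stand for one condition at two types, and \<open>iso\<close> and \<open>iso'\<close> for the same
  implication at those types: assumptions have fixed types, so a polymorphic fact must be supplied
  once per instance.\<close>

lemma equivalences:
  assumes sub: "submonoid T (plain_monoid (permissible_monoid S))"
    and T: "T \<subseteq> carrier S // sigma S"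
    and cond: "T = carrier S // sigma S \<longleftrightarrow> cond (carrier S // sigma S) (projections S) (munn_ext S)"
    and iso: "iso_to_W TYPE('a set) TYPE('a) cond S \<Longrightarrow>
      cond (carrier S // sigma S) (projections S) (munn_ext S)"
    and iso': "iso_to_W TYPE('t) TYPE('y) cond' S \<Longrightarrow>
      cond (carrier S // sigma S) (projections S) (munn_ext S)"
    and factorizable: "factorizable \<longleftrightarrow> (\<forall>s\<in>carrier S. \<exists>A\<in>T. s \<in> A)"
  shows "(factorizable \<longleftrightarrow> almost_T_proper S T) \<and>
    (factorizable \<longleftrightarrow> cond (carrier S // sigma S) (projections S) (munn_ext S)) \<and>
    (factorizable \<longleftrightarrow> iso_to_W TYPE('a set) TYPE('a) cond S) \<and>
    (iso_to_W TYPE('t) TYPE('y) cond' S \<longrightarrow> factorizable)"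
proof -
  have all: "factorizable \<longleftrightarrow> T = carrier S // sigma S"
    unfolding factorizable using T by (rule covered_iff_all_sigma_classes)
  moreover have "almost_T_proper S T \<longleftrightarrow> T = carrier S // sigma S"
    unfolding almost_T_proper_def using T sub by (rule T_proper_iff_all_sigma_classes)
  \<comment> \<open>Once \<open>T\<close> consists of all \<sigma>-classes, \<open>sub\<close>
    states that these classes form a submonoid, as the representation over them requires.\<close>
  moreover have "iso_to_W TYPE('a set) TYPE('a) cond S" if "T = carrier S // sigma S"
    using sub cond that by (intro iso_to_W_munn) simp_all
  ultimately show ?thesis
    using cond iso iso' by blast
qed

end

theorem proposition8p2:
  fixes S :: "'a rsemigroup"
  assumes "restriction_semigroup S"
    and "proper S"
  shows
  "((almost_left_factorizable S \<longleftrightarrow> almost_T_proper S (R_class_one (permissible_monoid S))) \<and>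
   (almost_left_factorizable S \<longleftrightarrow> acts_by_endomorphisms (carrier S // sigma S) (projections S) (munn_ext S)) \<and>
   (almost_left_factorizable S \<longleftrightarrow> iso_to_W TYPE('a set) TYPE('a) acts_by_endomorphisms S) \<and>
   (iso_to_W TYPE('t) TYPE('y) acts_by_endomorphisms S \<longrightarrow> almost_left_factorizable S)) \<and>
   ((almost_right_factorizable S \<longleftrightarrow> almost_T_proper S (L_class_one (permissible_monoid S))) \<and>
   (almost_right_factorizable S \<longleftrightarrow> acts_by_onto_maps (carrier S // sigma S) (projections S) (munn_ext S)) \<and>
   (almost_right_factorizable S \<longleftrightarrow> iso_to_W TYPE('a set) TYPE('a) acts_by_onto_maps S) \<and>
   (iso_to_W TYPE('t) TYPE('y) acts_by_onto_maps S \<longrightarrow> almost_right_factorizable S)) \<and>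
   ((almost_factorizable S \<longleftrightarrow> almost_T_proper S (H_class_one (permissible_monoid S))) \<and>
   (almost_factorizable S \<longleftrightarrow> acts_by_automorphisms (carrier S // sigma S) (projections S) (munn_ext S)) \<and>
   (almost_factorizable S \<longleftrightarrow> iso_to_W TYPE('a set) TYPE('a) acts_by_automorphisms S) \<and>
   (iso_to_W TYPE('t) TYPE('y) acts_by_automorphisms S \<longrightarrow> almost_factorizable S))"
proof -
  let ?C = "permissible_monoid S" and ?Q = "carrier S // sigma S"
  interpret proper_restriction_semigroup S
    using assms by (simp add: proper_restriction_semigroup_def proper_restriction_semigroup_axioms_def)
  interpret C: restriction_monoid ?C by (rule restriction_monoid_permissible_monoid)
  note R = R_class_one_permissible_monoid and L = L_class_one_permissible_monoid
  have sub: "R_class_one ?C \<subseteq> ?Q" "L_class_one ?C \<subseteq> ?Q" "H_class_one ?C \<subseteq> ?Q"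
    unfolding R L H_class_one_eq by blast+
  have cond: "R_class_one ?C = ?Q \<longleftrightarrow> acts_by_endomorphisms ?Q (projections S) (munn_ext S)"
    "L_class_one ?C = ?Q \<longleftrightarrow> acts_by_onto_maps ?Q (projections S) (munn_ext S)"
    "H_class_one ?C = ?Q \<longleftrightarrow> acts_by_automorphisms ?Q (projections S) (munn_ext S)"
    unfolding R L H_class_one_eq acts_by_endomorphisms_def acts_by_onto_maps_def
      acts_by_automorphisms_def by blast+
  \<comment> \<open>The two premises left open in each instance are the passages from
    \<open>W\<close> to the Munn action; the final proof step discharges them.\<close>
  note left = equivalences[where cond = acts_by_endomorphisms and cond' = acts_by_endomorphisms,
      OF C.submonoid_R_class_one sub(1) cond(1) _ _ almost_left_factorizable_def]
    and right = equivalences[where cond = acts_by_onto_maps and cond' = acts_by_onto_maps,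
      OF C.submonoid_L_class_one sub(2) cond(2) _ _ almost_right_factorizable_def]
    and both = equivalences[where cond = acts_by_automorphisms and cond' = acts_by_automorphisms,
      OF C.submonoid_H_class_one sub(3) cond(3) _ _ almost_factorizable_def]
  show ?thesis
    by (rule conjI[OF _ conjI]; (rule left | rule right | rule both);
        (erule endomorphisms_of_iso_to_W | erule onto_maps_of_iso_to_W | erule automorphisms_of_iso_to_W))
qed

end
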